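(* Let $H$ be a multigraph obtained from a triangle $K_3$ by fattening two of its edges and replacing the third by two parallel edges. Then $H$ is widespread.
   Context: All graphs are finite and simple; all multigraphs are finite and loopless. Fattening an edge $e=uv$ of a multigraph means replacing $e$ by some nonempty set of parallel edges all joining $u,v$. If $H$ is a multigraph, a subdivision of $H$ is a (simple) graph $J$ obtained from $H$ by replacing each edge $uv$ by a path of length at least one joining $u,v$, such that these paths are vertex-disjoint except for their ends. A graph $G$ is $J$-subdivision-free if no induced subgraph of $G$ is (isomorphic to) a subdivision of $J$. For an integer $\rho\ge 0$ and $v\in V(G)$, $N^{\rho}_G[v]$ is the set of vertices of $G$ with distance at most $\rho$ from $v$, and $\chi^{\rho}(G)$ is the maximum over all $v\in V(G)$ of the chromatic number of $G[N^{\rho}_G[v]]$ (zero for the null graph). An ideal is a class of graphs closed under taking induced subgraphs (up to isomorphism). An ideal $\mathcal{C}$ is colourable if there exists $k$ such that every member of $\mathcal{C}$ has chromatic number at most $k$; it is $\rho$-bounded if there exists $\tau$ such that $\chi^{\rho}(G)\le\tau$ for all $G\in\mathcal{C}$. A multigraph $H$ is widespread if for every subdivision $J$ of $H$ there exists $\rho\ge 0$ such that every $\rho$-bounded ideal of $J$-subdivision-free graphs is colourable. *)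

theory Defs
  imports "Graph_Theory.Graph_Theory"
begin

text \<open>
  A finite simple graph is a \<^typ>\<open>'a pair_pre_digraph\<close> satisfying \<^locale>\<open>pair_graph\<close>: finitely many
  vertices and a symmetric, irreflexive arc relation. The digraph library has no undirected
  multigraphs, so these are a record of their own, with edges mapped to unordered pairs of ends.
  Classes of graphs are sets of graphs on vertices of type \<^typ>\<open>nat\<close>, since every finite graph is
  isomorphic to one of these.
\<close>

record ('v, 'e) multigraph =
  mverts :: "'v set"
  medges :: "'e set"
  mends :: "'e \<Rightarrow> 'v set"

definition is_multigraph :: "('v, 'e) multigraph \<Rightarrow> bool" where
  "is_multigraph H \<longleftrightarrow> finite (mverts H) \<and> finite (medges H) \<and>
     (\<forall>e\<in>medges H. mends H e \<subseteq> mverts H \<and> card (mends H e) = 2)"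

definition multigraph_of :: "'a pair_pre_digraph \<Rightarrow> ('a, 'a set) multigraph" where
  "multigraph_of G = \<lparr> mverts = pverts G, medges = {{u, v} |u v. (u, v) \<in> parcs G}, mends = (\<lambda>e. e) \<rparr>"

definition is_triangle :: "('v, 'e) multigraph \<Rightarrow> bool" where
  "is_triangle T \<longleftrightarrow> is_multigraph T \<and> card (mverts T) = 3 \<and>
     bij_betw (mends T) (medges T) {S. S \<subseteq> mverts T \<and> card S = 2}"

text \<open>The set \<open>F\<close> of new edges may reuse \<open>e\<close> itself, but no other edge of \<open>H\<close>.\<close>

definition replaces_edge ::
  "('v, 'e) multigraph \<Rightarrow> 'e \<Rightarrow> 'e set \<Rightarrow> ('v, 'e) multigraph \<Rightarrow> bool" where
  "replaces_edge H e F H' \<longleftrightarrow> e \<in> medges H \<and> finite F \<and> F \<inter> (medges H - {e}) = {} \<and>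
     H' = \<lparr> mverts = mverts H, medges = (medges H - {e}) \<union> F,
            mends = (\<lambda>f. if f \<in> F then mends H e else mends H f) \<rparr>"

definition fattens :: "('v, 'e) multigraph \<Rightarrow> 'e \<Rightarrow> ('v, 'e) multigraph \<Rightarrow> bool" where
  "fattens H e H' \<longleftrightarrow> (\<exists>F. F \<noteq> {} \<and> replaces_edge H e F H')"

text \<open>
  \<open>\<phi>\<close> embeds the vertices of \<open>H\<close>, and \<open>P e\<close> is the path replacing the edge \<open>e\<close>; it has length at
  least one because the two ends of \<open>e\<close> are distinct. The paths must be edge-disjoint as well:
  otherwise two parallel edges of \<open>H\<close> could share one and the same one-edge path, although leaving
  both of them unsubdivided does not give a simple graph.
\<close>

definition is_subdivision :: "'a pair_pre_digraph \<Rightarrow> ('v, 'e) multigraph \<Rightarrow> bool" where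
  "is_subdivision J H \<longleftrightarrow> pair_graph J \<and> is_multigraph H \<and>
     (\<exists>\<phi> P. inj_on \<phi> (mverts H) \<and>
        (\<forall>e\<in>medges H. vpath (P e) (with_proj J) \<and> {hd (P e), last (P e)} = \<phi> ` mends H e \<and>
           set (P e) \<inter> \<phi> ` mverts H = \<phi> ` mends H e) \<and>
        (\<forall>e\<in>medges H. \<forall>f\<in>medges H. e \<noteq> f \<longrightarrow>
           set (P e) \<inter> set (P f) = \<phi> ` (mends H e \<inter> mends H f) \<and>
           symcl (set (vwalk_arcs (P e))) \<inter> symcl (set (vwalk_arcs (P f))) = {}) \<and>
        pverts J = \<phi> ` mverts H \<union> (\<Union>e\<in>medges H. set (P e)) \<and>
        parcs J = (\<Union>e\<in>medges H. symcl (set (vwalk_arcs (P e)))))"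

text \<open>\<open>iso_induced K G\<close>: some induced subgraph of \<open>G\<close> is isomorphic to \<open>K\<close>.\<close>

definition iso_induced :: "'b pair_pre_digraph \<Rightarrow> 'a pair_pre_digraph \<Rightarrow> bool" where
  "iso_induced K G \<longleftrightarrow> (\<exists>L. induced_subgraph (with_proj L) (with_proj G) \<and>
     digraph_iso (with_proj L) (with_proj K))"

definition subdivision_free :: "('v, 'e) multigraph \<Rightarrow> nat pair_pre_digraph \<Rightarrow> bool" where
  "subdivision_free H G \<longleftrightarrow> \<not> (\<exists>K :: nat pair_pre_digraph. is_subdivision K H \<and> iso_induced K G)"

definition has_colouring :: "('a, 'b) pre_digraph \<Rightarrow> nat \<Rightarrow> bool" where
  "has_colouring G k \<longleftrightarrow>
     (\<exists>c :: 'a \<Rightarrow> nat. c ` verts G \<subseteq> {..<k} \<and> (\<forall>(u, v)\<in>arcs_ends G. c u \<noteq> c v))"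

definition chromatic_number :: "('a, 'b) pre_digraph \<Rightarrow> nat" where
  "chromatic_number G = (LEAST k. has_colouring G k)"

text \<open>The distance is the least cost of a walk when every arc has cost 1 (infinite if there is no walk).\<close>

definition closed_nbhd :: "'a pair_pre_digraph \<Rightarrow> nat \<Rightarrow> 'a \<Rightarrow> 'a set" where
  "closed_nbhd G \<rho> v = {u \<in> pverts G. wf_digraph.\<mu> (with_proj G) (\<lambda>_. 1) v u \<le> ereal (real \<rho>)}"

definition local_chromatic_number :: "nat \<Rightarrow> 'a pair_pre_digraph \<Rightarrow> nat" where
  "local_chromatic_number \<rho> G = (if pverts G = {} then 0
     else Max ((\<lambda>v. chromatic_number (with_proj G \<restriction> closed_nbhd G \<rho> v)) ` pverts G))"

definition is_ideal :: "nat pair_pre_digraph set \<Rightarrow> bool" where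
  "is_ideal C \<longleftrightarrow> (\<forall>G\<in>C. pair_graph G) \<and>
     (\<forall>G\<in>C. \<forall>K. pair_graph K \<and> iso_induced K G \<longrightarrow> K \<in> C)"

definition colourable :: "nat pair_pre_digraph set \<Rightarrow> bool" where
  "colourable C \<longleftrightarrow> (\<exists>k. \<forall>G\<in>C. chromatic_number (with_proj G) \<le> k)"

definition rho_bounded :: "nat \<Rightarrow> nat pair_pre_digraph set \<Rightarrow> bool" where
  "rho_bounded \<rho> C \<longleftrightarrow> (\<exists>\<tau>. \<forall>G\<in>C. local_chromatic_number \<rho> G \<le> \<tau>)"

definition widespread :: "('v, 'e) multigraph \<Rightarrow> bool" where
  "widespread H \<longleftrightarrow> (\<forall>J :: nat pair_pre_digraph. is_subdivision J H \<longrightarrow>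
     (\<exists>\<rho>. \<forall>C. is_ideal C \<and> rho_bounded \<rho> C \<and>
        (\<forall>G\<in>C. subdivision_free (multigraph_of J) G) \<longrightarrow> colourable C))"

end

theory Submission
  imports Defs
begin

text \<open>
  Let all balls of radius \<open>R + 1\<close> in \<open>G\<close> have bounded chromatic number, and let \<open>G\<close> have huge
  chromatic number. Nested breadth-first levellings give, for \<open>i < n\<close>, a connected set \<open>U i\<close>
  (the levels up to the last but two), a set \<open>M i\<close> (the last level but one), and a set \<open>E\<close> inside
  all the top levels, still of large chromatic number, such that every vertex of \<open>E\<close> has a parent
  in each \<open>M i\<close>, every vertex of \<open>M i\<close> has a neighbour in \<open>U i\<close>, and \<open>U i\<close> has no edges to \<open>E\<close>
  or to \<open>U j\<close> and \<open>M j\<close> with \<open>i < j\<close>. Passing to a subset of \<open>E\<close>, whether the parent of \<open>d\<close> in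
  \<open>M i\<close> has a neighbour in \<open>U j\<close> depends only on \<open>i < j\<close> and not on \<open>d \<in> E\<close>.

  If there are many indices no two of which are so related, then any three vertices of \<open>E\<close> far from
  one another are joined pairwise by as many paths as we like, through their parents and the sets
  \<open>U j\<close>. Otherwise some \<open>l\<close> is related to many \<open>j\<close>, and the parents in \<open>M l\<close> serve as branch
  vertices: all of them have neighbours in the connected and mutually anticomplete sets \<open>E\<close> and
  \<open>U j\<close>. Of three parents far from one another, at least two pairs can be joined within \<open>U j\<close>
  avoiding the star of the third, so some parent \<open>a\<close> is joined to both others \<open>b, c\<close> in this way
  for many \<open>j\<close>. One path between \<open>b\<close> and \<open>c\<close> runs through \<open>U l\<close>. The second runs through \<open>E\<close>:
  the three parents can be chosen so that within \<open>E\<close> all three pairs can be joined avoiding the star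
  of the third, since otherwise \<open>E\<close> would be coloured with few colours.
\<close>

section \<open>Graphs as adjacency relations\<close>

locale simple_graph =
  fixes V :: "'a set" and adj :: "'a \<Rightarrow> 'a \<Rightarrow> bool"
  assumes finite_V: "finite V"
    and adj_sym: "adj x y \<Longrightarrow> adj y x"
    and adj_irrefl: "\<not> adj x x"
    and adj_in_V: "adj x y \<Longrightarrow> x \<in> V"
begin

definition colourable_set :: "'a set \<Rightarrow> nat \<Rightarrow> bool" where
  "colourable_set X k \<longleftrightarrow>
     (\<exists>c :: 'a \<Rightarrow> nat. (\<forall>x\<in>X. c x < k) \<and> (\<forall>x\<in>X. \<forall>y\<in>X. adj x y \<longrightarrow> c x \<noteq> c y))"

text \<open>The closure is reflexive, so \<open>reach X u u\<close> holds even for \<open>u\<close>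
  outside \<open>X\<close>. Hence \<open>component X u\<close> always contains \<open>u\<close>, and
  the lemmas below carry the side condition \<open>u \<in> X\<close>.\<close>

definition reach :: "'a set \<Rightarrow> 'a \<Rightarrow> 'a \<Rightarrow> bool" where
  "reach X = (\<lambda>x y. adj x y \<and> x \<in> X \<and> y \<in> X)\<^sup>*\<^sup>*"

definition component :: "'a set \<Rightarrow> 'a \<Rightarrow> 'a set" where
  "component X u = {v. reach X u v}"

definition conn :: "'a set \<Rightarrow> bool" where
  "conn X \<longleftrightarrow> (\<forall>u\<in>X. \<forall>v\<in>X. reach X u v)"

text \<open>Built by adding neighbours rather than through a distance function, so that the triangle
  inequality is a plain induction and centres outside \<open>V\<close> are allowed.\<close>

primrec ball :: "nat \<Rightarrow> 'a \<Rightarrow> 'a set" where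
  "ball 0 x = {x}"
| "ball (Suc n) x = ball n x \<union> {z. \<exists>y\<in>ball n x. adj y z}"

definition anticomplete :: "'a set \<Rightarrow> 'a set \<Rightarrow> bool" where
  "anticomplete X Y \<longleftrightarrow> X \<inter> Y = {} \<and> (\<forall>x\<in>X. \<forall>y\<in>Y. \<not> adj x y)"

text \<open>Stands for a path from \<open>a\<close> to \<open>b\<close> through \<open>X\<close>
  whose inside avoids the star of \<open>c\<close>. Keeping a connected set postpones the choice of
  an induced path to the very end.\<close>

definition link :: "'a set \<Rightarrow> 'a \<Rightarrow> 'a \<Rightarrow> 'a \<Rightarrow> bool" where
  "link X a b c \<longleftrightarrow> (\<exists>W\<subseteq>X. conn W \<and> (\<exists>v\<in>W. adj a v) \<and> (\<exists>v\<in>W. adj b v) \<and> (\<forall>v\<in>W. \<not> adj c v))"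

lemma link_commute: "link X a b c \<longleftrightarrow> link X b a c"
  unfolding link_def by blast

subsection \<open>Connectivity\<close>

lemma reach_refl [simp]: "reach X u u"
  by (simp add: reach_def)

lemma reach_trans: "reach X u v \<Longrightarrow> reach X v w \<Longrightarrow> reach X u w"
  unfolding reach_def by simp

lemma reach_sym: "reach X u v \<Longrightarrow> reach X v u"
proof -
  have "symp (\<lambda>x y. adj x y \<and> x \<in> X \<and> y \<in> X)"
    by (auto simp: symp_def intro: adj_sym)
  then show "reach X u v \<Longrightarrow> reach X v u"
    unfolding reach_def by (meson symp_def symp_rtranclp)
qed

lemma reach_adj: "adj x y \<Longrightarrow> x \<in> X \<Longrightarrow> y \<in> X \<Longrightarrow> reach X x y"
  unfolding reach_def by auto

lemma reach_in: "reach X u v \<Longrightarrow> u \<in> X \<Longrightarrow> v \<in> X"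
  unfolding reach_def by (induction rule: rtranclp_induct) auto

lemma reach_mono: "reach X u v \<Longrightarrow> X \<subseteq> Y \<Longrightarrow> reach Y u v"
  unfolding reach_def by (erule rtranclp_mono[THEN predicate2D, rotated]) auto

lemma component_subset: "u \<in> X \<Longrightarrow> component X u \<subseteq> X"
  unfolding component_def using reach_in by blast

lemma in_component [simp]: "u \<in> component X u"
  by (simp add: component_def)

lemma component_closed: "v \<in> component X u \<Longrightarrow> u \<in> X \<Longrightarrow> adj v w \<Longrightarrow> w \<in> X \<Longrightarrow> w \<in> component X u"
  by (smt (verit) component_def mem_Collect_eq reach_adj reach_in reach_trans)

lemma component_eq: "v \<in> component X u \<Longrightarrow> component X v = component X u"
  unfolding component_def using reach_trans reach_sym by blast

lemma reach_component: "reach X u v \<Longrightarrow> reach (component X u) u v"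
  unfolding reach_def component_def
proof (induction rule: rtranclp_induct)
  case (step y z)
  then show ?case
    by (smt (verit) mem_Collect_eq rtranclp.rtrancl_into_rtrancl)
qed simp

lemma conn_component [simp]: "conn (component X u)"
  unfolding conn_def
  by (metis component_def mem_Collect_eq reach_component reach_sym reach_trans)

lemma conn_insert:
  assumes "conn X" "x \<in> X" "adj x y" shows "conn (insert y X)"
proof -
  have r: "reach (insert y X) u v" if "u \<in> X" "v \<in> X" for u v
    using assms(1) that reach_mono[of X u v "insert y X"] unfolding conn_def by blast
  have xy: "reach (insert y X) x y" using assms by (intro reach_adj) auto
  show ?thesis unfolding conn_def
    using r xy assms(2) by (metis insert_iff reach_refl reach_sym reach_trans)
qed

lemma conn_singleton [simp]: "conn {x}"
  by (simp add: conn_def)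

text \<open>Otherwise \<open>X\<close> would be closed under walking inside \<open>C\<close>.
  Applied to a component, it yields a vertex at which an exploration is stopped.\<close>

lemma crossing_edge:
  assumes "conn C" "X \<subseteq> C" "X \<noteq> {}" "C - X \<noteq> {}"
  shows "\<exists>x\<in>X. \<exists>y\<in>C - X. adj x y"
proof (rule ccontr)
  assume neg: "\<not> ?thesis"
  obtain u v where uv: "u \<in> X" "v \<in> C - X" using assms by blast
  have "reach C u v" using assms uv unfolding conn_def by blast
  then have "v \<in> X" unfolding reach_def
    by (induction rule: rtranclp_induct) (use uv neg in auto)
  then show False using uv by blast
qed

subsection \<open>Balls\<close>

lemma ball_mono: "m \<le> n \<Longrightarrow> ball m x \<subseteq> ball n x"
  by (induction n) (auto simp: le_Suc_eq)

lemma in_ball_self [simp]: "x \<in> ball n x"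
  by (induction n) auto

lemma ball_add: "y \<in> ball m x \<Longrightarrow> z \<in> ball n y \<Longrightarrow> z \<in> ball (m + n) x"
proof (induction n arbitrary: z)
  case (Suc n)
  show ?case
  proof (cases "z \<in> ball n y")
    case True
    then show ?thesis using Suc by auto
  next
    case False
    then obtain w where "w \<in> ball n y" "adj w z" using Suc.prems by auto
    then show ?thesis using Suc.IH[OF Suc.prems(1)] by auto
  qed
qed auto

lemma adj_ball: "adj x y \<Longrightarrow> y \<in> ball 1 x"
  by auto

lemma ball_sym: "y \<in> ball n x \<Longrightarrow> x \<in> ball n y"
proof (induction n arbitrary: y)
  case (Suc n)
  show ?case
  proof (cases "y \<in> ball n x")
    case True
    then show ?thesis using Suc by auto
  next
    case False
    then obtain w where w: "w \<in> ball n x" "adj w y" using Suc.prems by auto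
    have "w \<in> ball 1 y" using w(2) adj_sym by auto
    then show ?thesis using ball_add[of w 1 y x n] Suc.IH[OF w(1)] by simp
  qed
qed auto

lemma far_no_common_nbr:
  assumes "b \<notin> ball R a" "2 \<le> R" shows "\<not> (adj a v \<and> adj b v)"
proof
  assume "adj a v \<and> adj b v"
  then have "v \<in> ball 1 a" "b \<in> ball 1 v" using adj_sym by auto
  then have "b \<in> ball 2 a" using ball_add[of v 1 a b 1] by (simp add: numeral_2_eq_2)
  then show False using assms ball_mono by blast
qed

lemma far_not_adj:
  assumes "b \<notin> ball R a" "1 \<le> R" shows "\<not> adj a b"
  using assms adj_ball ball_mono by blast

subsection \<open>Colourings\<close>

lemma colourable_setI:
  assumes "\<And>x. x \<in> X \<Longrightarrow> c x < k" "\<And>x y. x \<in> X \<Longrightarrow> y \<in> X \<Longrightarrow> adj x y \<Longrightarrow> c x \<noteq> c y"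
  shows "colourable_set X k"
  unfolding colourable_set_def using assms by (intro exI[of _ c]) auto

lemma colourable_setE:
  assumes "colourable_set X k"
  obtains c where "\<forall>x\<in>X. c x < k" "\<forall>x\<in>X. \<forall>y\<in>X. adj x y \<longrightarrow> c x \<noteq> c y"
  using assms unfolding colourable_set_def by (elim exE conjE) (rule that)

lemma colourable_set_mono: "colourable_set Y k \<Longrightarrow> X \<subseteq> Y \<Longrightarrow> k \<le> l \<Longrightarrow> colourable_set X l"
  unfolding colourable_set_def by (meson less_le_trans subsetD)

lemma colourable_set_fibres:
  fixes f :: "'a \<Rightarrow> 'b"
  assumes "finite I" "f ` X \<subseteq> I" "\<And>i. i \<in> I \<Longrightarrow> colourable_set {x\<in>X. f x = i} k"
  shows "colourable_set X (card I * k)"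
proof -
  obtain h where h: "bij_betw h I {..<card I}"
    using assms(1) ex_bij_betw_finite_nat atLeast0LessThan by metis
  define proper where "proper i c \<longleftrightarrow> (\<forall>x\<in>{x\<in>X. f x = i}. c x < k) \<and>
    (\<forall>x\<in>{x\<in>X. f x = i}. \<forall>y\<in>{x\<in>X. f x = i}. adj x y \<longrightarrow> c x \<noteq> (c y :: nat))" for i c
  have "\<forall>i\<in>I. \<exists>c. proper i c"
    using assms(3) unfolding colourable_set_def proper_def by blast
  then obtain c where "\<forall>i\<in>I. proper i (c i)" by (rule bchoice[THEN exE])
  then have c: "\<And>i x. i \<in> I \<Longrightarrow> x \<in> X \<Longrightarrow> f x = i \<Longrightarrow> c i x < k"
    "\<And>i x y. i \<in> I \<Longrightarrow> x \<in> X \<Longrightarrow> y \<in> X \<Longrightarrow> f x = i \<Longrightarrow> f y = i \<Longrightarrow> adj x y \<Longrightarrow> c i x \<noteq> c i y"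
    unfolding proper_def by blast+
  \<comment> \<open>Quotient and remainder modulo \<open>k\<close> recover the fibre and the colour
    within it.\<close>
  define d where "d x = h (f x) * k + c (f x) x" for x
  have "d x < card I * k" if "x \<in> X" for x
  proof -
    have fx: "f x \<in> I" using assms(2) that by blast
    then have "Suc (h (f x)) \<le> card I" using h bij_betwE by fastforce
    then have "Suc (h (f x)) * k \<le> card I * k" by (rule mult_le_mono1)
    then show ?thesis unfolding d_def using c(1)[OF fx that] by simp
  qed
  moreover have "d x \<noteq> d y" if xy: "x \<in> X" "y \<in> X" "adj x y" for x y
  proof
    assume eq: "d x = d y"
    have fx: "f x \<in> I" "f y \<in> I" using assms(2) that by blast+
    have lt: "c (f x) x < k" "c (f y) y < k" using c(1) fx xy by blast+
    have "d x div k = h (f x)" "d y div k = h (f y)" unfolding d_def using lt by auto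
    then have "h (f x) = h (f y)" using eq by simp
    then have ff: "f x = f y" using h fx unfolding bij_betw_def inj_on_def by blast
    then have "c (f x) x = c (f x) y" using eq unfolding d_def by simp
    then show False using c(2)[OF fx(1) xy(1,2) refl ff[symmetric] xy(3)] by simp
  qed
  ultimately show ?thesis by (intro colourable_setI)
qed

lemma colourable_set_Un:
  assumes "colourable_set X k" "colourable_set Y l"
  shows "colourable_set (X \<union> Y) (k + l)"
proof -
  obtain c where c: "\<forall>x\<in>X. c x < k" "\<forall>x\<in>X. \<forall>y\<in>X. adj x y \<longrightarrow> c x \<noteq> c y"
    using assms(1) by (rule colourable_setE)
  obtain d where d: "\<forall>x\<in>Y. d x < l" "\<forall>x\<in>Y. \<forall>y\<in>Y. adj x y \<longrightarrow> d x \<noteq> d y"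
    using assms(2) by (rule colourable_setE)
  have "(if x \<in> X then c x else k + d x) \<noteq> (if y \<in> X then c y else k + d y)"
    if "x \<in> X \<union> Y" "y \<in> X \<union> Y" "adj x y" for x y
  proof (cases "x \<in> X \<longleftrightarrow> y \<in> X")
    case True
    then show ?thesis using c(2) d(2) that by auto
  next
    case False
    then show ?thesis using c(1) by (metis not_add_less1)
  qed
  moreover have "(if x \<in> X then c x else k + d x) < k + l" if "x \<in> X \<union> Y" for x
    using that c(1) d(1) by auto
  ultimately show ?thesis by (intro colourable_setI)
qed

text \<open>Neighbours lie on levels that differ by at most one, so neighbours on levels of equal
  parity share their level. All even levels can therefore use one palette and all odd levels
  another.\<close>

lemma colourable_set_levels:
  fixes h :: "'a \<Rightarrow> nat"
  assumes lev: "\<And>i. colourable_set {x\<in>X. h x = i} k"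
    and step: "\<And>x y. x \<in> X \<Longrightarrow> y \<in> X \<Longrightarrow> adj x y \<Longrightarrow> h x \<le> Suc (h y)"
  shows "colourable_set X (2 * k)"
proof -
  define proper where "proper i c \<longleftrightarrow> (\<forall>x\<in>{x\<in>X. h x = i}. c x < k) \<and>
    (\<forall>x\<in>{x\<in>X. h x = i}. \<forall>y\<in>{x\<in>X. h x = i}. adj x y \<longrightarrow> c x \<noteq> (c y :: nat))" for i c
  have "\<forall>i. \<exists>c. proper i c"
    using lev unfolding colourable_set_def proper_def by blast
  then obtain c where "\<forall>i. proper i (c i)" by (rule choice[THEN exE])
  then have c: "\<And>i x. x \<in> X \<Longrightarrow> h x = i \<Longrightarrow> c i x < k"
    "\<And>i x y. x \<in> X \<Longrightarrow> y \<in> X \<Longrightarrow> h x = i \<Longrightarrow> h y = i \<Longrightarrow> adj x y \<Longrightarrow> c i x \<noteq> c i y"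
    unfolding proper_def by blast+
  have "colourable_set {x \<in> X. even (h x) = b} k" for b
  proof -
    have same: "h x = h y" if "x \<in> X" "y \<in> X" "even (h x) = even (h y)" "adj x y" for x y
      using step[OF that(1,2,4)] step[OF that(2,1) adj_sym[OF that(4)]] that(3)
      by (metis even_Suc le_SucE le_antisym)
    show ?thesis
    proof (rule colourable_setI[of _ "\<lambda>x. c (h x) x"])
      fix x y assume xy: "x \<in> {x \<in> X. even (h x) = b}" "y \<in> {x \<in> X. even (h x) = b}" "adj x y"
      have eq: "h y = h x" by (rule same[symmetric]) (use xy in auto)
      have "c (h x) x \<noteq> c (h x) y" by (rule c(2)) (use xy eq in auto)
      then show "c (h x) x \<noteq> c (h y) y" by (simp only: eq not_False_eq_True)
    qed (use c(1) in simp)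
  qed
  from colourable_set_fibres[of UNIV "\<lambda>x. even (h x)" X, OF _ _ this] show ?thesis
    by (simp add: card_UNIV_bool)
qed

lemma colourable_set_components:
  assumes "\<And>u. u \<in> X \<Longrightarrow> colourable_set (component X u) k"
  shows "colourable_set X k"
proof -
  let ?Q = "(component X) ` X"
  \<comment> \<open>A colouring is chosen for each component as a set, not for each vertex, so that
    all vertices of a component use the same one.\<close>
  have "\<forall>C\<in>?Q. \<exists>c. (\<forall>x\<in>C. c x < k) \<and> (\<forall>x\<in>C. \<forall>y\<in>C. adj x y \<longrightarrow> c x \<noteq> (c y :: nat))"
    using assms unfolding colourable_set_def by blast
  then obtain c where c: "\<forall>C\<in>?Q. (\<forall>x\<in>C. c C x < k) \<and> (\<forall>x\<in>C. \<forall>y\<in>C. adj x y \<longrightarrow> c C x \<noteq> (c C y :: nat))"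
    by (rule bchoice[THEN exE])
  have "c (component X x) x \<noteq> c (component X y) y" if "x \<in> X" "y \<in> X" "adj x y" for x y
  proof -
    have y: "y \<in> component X x" using that component_closed[of x X x y] by simp
    then have "component X y = component X x" by (rule component_eq)
    then show ?thesis using c y that by auto
  qed
  moreover have "c (component X x) x < k" if "x \<in> X" for x using c that by simp
  ultimately show ?thesis by (rule colourable_setI[of _ "\<lambda>x. c (component X x) x", rotated])
qed

lemma large_component:
  assumes "\<not> colourable_set X k"
  obtains D where "D \<subseteq> X" "conn D" "\<not> colourable_set D k"
proof -
  obtain u where "u \<in> X" "\<not> colourable_set (component X u) k"
    using assms colourable_set_components by blast
  then show thesis using that[of "component X u"] component_subset by simp
qed

section \<open>Asteroidal triples of points\<close>

text \<open>Explore \<open>U\<close> from \<open>u\<close> while avoiding the stars of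
  \<open>b\<close> and \<open>c\<close>. The exploration is stopped at a vertex \<open>y\<close> in
  one of these stars, and in only one, as \<open>b\<close> and \<open>c\<close> have no common
  neighbour. The explored part together with \<open>y\<close> is the required connected set.\<close>

lemma link_one_of_two:
  assumes U: "conn U" and a: "u \<in> U" "adj a u" and bc: "v \<in> U" "adj b v \<or> adj c v"
    and ab: "\<And>v. \<not> (adj a v \<and> adj b v)" and ac: "\<And>v. \<not> (adj a v \<and> adj c v)"
    and bc': "\<And>v. \<not> (adj b v \<and> adj c v)"
  shows "link U a b c \<or> link U a c b"
proof -
  define S where "S = {v\<in>U. \<not> adj b v \<and> \<not> adj c v}"
  define X where "X = component S u"
  have uS: "u \<in> S" using a ab ac unfolding S_def by blast
  then have XS: "X \<subseteq> S" unfolding X_def by (rule component_subset)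
  have uX: "u \<in> X" unfolding X_def by simp
  have "v \<in> U - X" using bc XS unfolding S_def by blast
  then obtain x y where xy: "x \<in> X" "y \<in> U - X" "adj x y"
    using crossing_edge[OF U, of X] XS uX unfolding S_def by blast
  have "y \<notin> S"
    using xy component_closed[of x S u y] uS unfolding X_def by blast
  then have y: "adj b y \<or> adj c y" using xy unfolding S_def by blast
  have conn: "conn (insert y X)" by (rule conn_insert[OF _ xy(1,3)]) (simp add: X_def)
  have sub: "insert y X \<subseteq> U" using xy XS unfolding S_def by blast
  show ?thesis
  proof (cases "adj b y")
    case True
    then have "\<forall>v\<in>insert y X. \<not> adj c v" using bc' XS unfolding S_def by blast
    then show ?thesis unfolding link_def using conn sub True uX a(2) by blast
  next
    case False
    then have "\<forall>v\<in>insert y X. \<not> adj b v" using XS unfolding S_def by blast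
    then show ?thesis unfolding link_def using conn sub False y uX a(2) by blast
  qed
qed

text \<open>Each of the three points belongs to at least one linked pair. Hence at least two of the
  three pairs are linked, and two pairs share a point.\<close>

lemma link_two_of_three:
  assumes U: "conn U" and nbrs: "\<exists>u\<in>U. adj a u" "\<exists>u\<in>U. adj b u" "\<exists>u\<in>U. adj c u"
    and ab: "\<And>v. \<not> (adj a v \<and> adj b v)" and ac: "\<And>v. \<not> (adj a v \<and> adj c v)"
    and bc: "\<And>v. \<not> (adj b v \<and> adj c v)"
  shows "link U a b c \<and> link U a c b \<or> link U b a c \<and> link U b c a \<or> link U c a b \<and> link U c b a"
proof -
  have "link U a b c \<or> link U a c b" using link_one_of_two[OF U] nbrs ab ac bc by metis
  moreover have "link U b a c \<or> link U b c a" using link_one_of_two[OF U] nbrs ab ac bc by metis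
  moreover have "link U c a b \<or> link U c b a" using link_one_of_two[OF U] nbrs ab ac bc by metis
  ultimately show ?thesis using link_commute by blast
qed

text \<open>An asteroidal triple in the usual sense, except that the paths run through
  \<open>E\<close>, to which the points themselves need not belong, and that the points are more
  than \<open>R\<close> apart.\<close>

definition asteroidal :: "nat \<Rightarrow> 'a set \<Rightarrow> 'a \<Rightarrow> 'a \<Rightarrow> 'a \<Rightarrow> bool" where
  "asteroidal R E x y z \<longleftrightarrow> y \<notin> ball R x \<and> z \<notin> ball R x \<and> z \<notin> ball R y \<and>
     link E x y z \<and> link E x z y \<and> link E y z x"

text \<open>
  Let \<open>y\<close> be the first point far from \<open>x\<close> that is met when \<open>C\<close> is explored from the star of \<open>x\<close>.
  For every far point \<open>z\<close> of \<open>C\<close>, the only possible obstruction to \<open>x, y, z\<close> being asteroidal is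
  that the star of \<open>y\<close> separates \<open>z\<close> from \<open>x\<close>. So without asteroidal triples, all of \<open>C\<close> except
  the balls around \<open>x\<close> and \<open>y\<close> lies in components behind the star of \<open>y\<close>, which are coloured
  recursively. Two palettes suffice since vertices behind the star of \<open>y\<close> do not touch that of \<open>x\<close>.
\<close>

lemma two_palettes:
  fixes r :: "'a \<Rightarrow> 'a"
  assumes no_ast: "\<And>x y z. \<lbrakk>x \<in> r ` E; y \<in> r ` E; z \<in> r ` E\<rbrakk> \<Longrightarrow> \<not> asteroidal R E x y z"
    and r: "\<And>e. e \<in> E \<Longrightarrow> adj (r e) e"
    and balls: "\<And>v. colourable_set (ball (Suc R) v) t" and R: "2 \<le> R"
    and C: "C \<subseteq> E" "conn C" "\<forall>v\<in>C. \<not> adj x v"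
    and x: "x \<in> r ` E" "g \<in> E" "adj x g" "e0 \<in> C" "adj g e0"
  shows "\<exists>c. (\<forall>u\<in>C. c u < 4 * t) \<and> (\<forall>u\<in>C. \<forall>v\<in>C. adj u v \<longrightarrow> c u \<noteq> c v) \<and>
     (\<forall>u\<in>C. (\<exists>h\<in>E. adj x h \<and> adj h u) \<longrightarrow> (c u < 2 * t \<longleftrightarrow> b))"
  using C x
\<comment> \<open>Centre and palette vary along with the set: the recursion passes to smaller sets
  with centre \<open>y\<close> and palette \<open>\<not> b\<close>.\<close>
proof (induction "card C" arbitrary: C x g e0 b rule: less_induct)
  case less
  have finC: "finite C"
    using less.prems(1) r adj_in_V adj_sym finite_V by (meson finite_subset subset_iff)
  define P where "P = {e\<in>C. r e \<notin> ball R x}"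
  \<comment> \<open>One round of colouring, shared by both cases below. Outside \<open>Hid\<close>,
    the part behind the star of \<open>y\<close>, everything lies in two balls and takes palette
    \<open>b\<close>; the components of \<open>Hid\<close> are left to the induction
    hypothesis.\<close>
  have layer: "\<exists>c. (\<forall>u\<in>C. c u < 4 * t) \<and> (\<forall>u\<in>C. \<forall>v\<in>C. adj u v \<longrightarrow> c u \<noteq> c v) \<and>
     (\<forall>u\<in>C. (\<exists>h\<in>E. adj x h \<and> adj h u) \<longrightarrow> (c u < 2 * t \<longleftrightarrow> b))"
    if y: "y \<in> r ` E \<or> Hid = {}" and Hid: "Hid \<subseteq> C" and lay: "\<And>e. e \<in> C - Hid \<Longrightarrow> r e \<in> ball R x \<union> ball R y"
      and comp: "\<And>u. u \<in> Hid \<Longrightarrow> component (C - {v. adj y v}) u \<subseteq> Hid"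
      and yfree: "\<And>u. u \<in> Hid \<Longrightarrow> \<not> adj y u"
      and yC: "e1 \<in> C" "Hid \<noteq> {} \<Longrightarrow> adj y e1"
      and xfree: "\<And>u h. u \<in> Hid \<Longrightarrow> h \<in> E \<Longrightarrow> adj x h \<Longrightarrow> \<not> adj h u"
    for y Hid e1
  proof -
    have near: "e \<in> ball (Suc R) v" if "e \<in> C" "r e \<in> ball R v" for e v
      using that r less.prems(1) by auto
    have "C - Hid \<subseteq> ball (Suc R) x \<union> ball (Suc R) y"
      using lay near by blast
    then have "colourable_set (C - Hid) (2 * t)"
      using colourable_set_mono[OF colourable_set_Un[OF balls balls], of "C - Hid" x y "2 * t"] by simp
    then obtain d where d: "\<forall>u\<in>C - Hid. d u < 2 * t" "\<forall>u\<in>C - Hid. \<forall>v\<in>C - Hid. adj u v \<longrightarrow> d u \<noteq> d v"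
      by (rule colourable_setE)
    define K where "K u = component (C - {v. adj y v}) u" for u
    define good where "good L c \<longleftrightarrow> (\<forall>u\<in>L. c u < 4 * t) \<and> (\<forall>u\<in>L. \<forall>v\<in>L. adj u v \<longrightarrow> c u \<noteq> (c v :: nat)) \<and>
        (\<forall>u\<in>L. (\<exists>h\<in>E. adj y h \<and> adj h u) \<longrightarrow> (c u < 2 * t \<longleftrightarrow> \<not> b))" for L c
    have "\<exists>c. good (K u) c" if u: "u \<in> Hid" for u
    proof -
      have uC: "u \<in> C - {v. adj y v}" using u Hid yfree by blast
      have KC: "K u \<subseteq> C - {v. adj y v}" unfolding K_def by (rule component_subset[OF uC])
      have e1: "e1 \<in> C - K u" "adj y e1" using KC yC u by blast+
      have "u \<in> K u" unfolding K_def by simp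
      then obtain p q where pq: "p \<in> K u" "q \<in> C - K u" "adj p q"
        using crossing_edge[OF less.prems(2), of "K u"] KC e1 by blast
      have "adj y q" using pq component_closed[of p "C - {v. adj y v}" u q] uC unfolding K_def by blast
      have "card (K u) < card C"
        using KC e1 finC by (intro psubset_card_mono) blast+
      \<comment> \<open>\<open>K u\<close> is left through \<open>q\<close>, a neighbour of
        \<open>y\<close>, so \<open>y\<close>, \<open>q\<close>, \<open>p\<close> take the roles of
        \<open>x\<close>, \<open>g\<close>, \<open>e0\<close>. The component is smaller because it
        misses \<open>e1\<close>.\<close>
      then show ?thesis unfolding good_def
        by (rule less.hyps[of _ y q p "\<not> b"])
          (use KC less.prems(1) y u pq \<open>adj y q\<close> adj_sym in \<open>auto simp: K_def\<close>)
    qed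
    then have "\<forall>L\<in>K ` Hid. \<exists>c. good L c" by blast
    then obtain cc where cc: "\<forall>L\<in>K ` Hid. good L (cc L)" by (rule bchoice[THEN exE])
    define c where "c u = (if u \<in> Hid then cc (K u) u else if b then d u else 2 * t + d u)" for u
    have 1: "c u < 4 * t" if "u \<in> C" for u
    proof (cases "u \<in> Hid")
      case True
      then have "good (K u) (cc (K u))" "u \<in> K u" using cc unfolding K_def by auto
      then show ?thesis unfolding good_def c_def using True by simp
    next
      case False
      then have "d u < 2 * t" using d that by blast
      then show ?thesis unfolding c_def using False by auto
    qed
    have palette: "c u < 2 * t \<longleftrightarrow> b" if "u \<in> C - Hid" for u
    proof -
      have "d u < 2 * t" using d that by blast
      then show ?thesis unfolding c_def using that by auto
    qed
    \<comment> \<open>Here \<open>u\<close> lies in the star of \<open>y\<close>, so it serves as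
      the \<open>h\<close> in the palette clause for \<open>v\<close> and forces \<open>v\<close>
      into the palette opposite to that of \<open>u\<close>.\<close>
    have cross: "c u \<noteq> c v" if uv: "u \<in> C - Hid" "v \<in> Hid" "adj u v" for u v
    proof -
      have vC: "v \<in> C - {v. adj y v}" using uv Hid yfree by blast
      have "u \<notin> K v" using comp[OF uv(2)] uv(1) unfolding K_def by blast
      then have "adj y u"
        using component_closed[of v "C - {v. adj y v}" v u] vC uv adj_sym unfolding K_def by auto
      moreover have "good (K v) (cc (K v))" "v \<in> K v" using cc uv unfolding K_def by auto
      moreover have "u \<in> E" using uv less.prems(1) by blast
      ultimately have "c v < 2 * t \<longleftrightarrow> \<not> b" using uv unfolding good_def c_def by auto
      then show ?thesis using palette[OF uv(1)] by auto
    qed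
    have inner: "c u \<noteq> c v" if uv: "u \<in> Hid" "v \<in> Hid" "adj u v" for u v
    proof -
      have uC: "u \<in> C - {v. adj y v}" "v \<in> C - {v. adj y v}" using uv Hid yfree by blast+
      have vK: "v \<in> K u" using component_closed[of u "C - {v. adj y v}" u v] uC uv unfolding K_def by simp
      then have "K v = K u" unfolding K_def by (rule component_eq)
      moreover have "good (K u) (cc (K u))" "u \<in> K u" using cc uv unfolding K_def by auto
      ultimately show ?thesis unfolding c_def good_def using uv vK by auto
    qed
    have outer: "c u \<noteq> c v" if "u \<in> C - Hid" "v \<in> C - Hid" "adj u v" for u v
      using d(2) that unfolding c_def by auto
    have 2: "c u \<noteq> c v" if "u \<in> C" "v \<in> C" "adj u v" for u v
      using cross[of u v] cross[of v u] inner[of u v] outer[of u v] that adj_sym by fastforce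
    have 3: "c u < 2 * t \<longleftrightarrow> b" if "u \<in> C" "h \<in> E" "adj x h" "adj h u" for u h
      using palette xfree that by blast
    show ?thesis by (intro exI[of _ c]) (use 1 2 3 in blast)
  qed
  show ?case
  proof (cases "P = {}")
    case True
    \<comment> \<open>No point is far from \<open>x\<close>, so nothing is hidden and
      \<open>x\<close> itself fills the place of \<open>y\<close>.\<close>
    then show ?thesis
      by (intro layer[of x "{}" e0]) (use less.prems in \<open>auto simp: P_def\<close>)
  next
    case False
    have notP: "g \<in> E" "e0 \<in> C" "adj g e0" using less.prems by auto
    \<comment> \<open>Explore \<open>C\<close> from \<open>e0\<close> outside the stars of all far
      points. The vertex \<open>e\<close> at which this stops lies in the star of some
      \<open>r p\<close>, which becomes \<open>y\<close>; \<open>W\<close> is a connected set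
      leading from \<open>e0\<close> to \<open>e\<close>.\<close>
    define S where "S = {e\<in>C. \<forall>p\<in>P. \<not> adj (r p) e}"
    have "\<exists>p\<in>P. \<exists>e\<in>C. \<exists>W\<subseteq>C. conn W \<and> e0 \<in> W \<and> e \<in> W \<and> adj (r p) e \<and> W - {e} \<subseteq> S"
    proof (cases "e0 \<in> S")
      case False
      then obtain p where "p \<in> P" "adj (r p) e0" using notP unfolding S_def by blast
      then show ?thesis using notP by (intro bexI[of _ p] bexI[of _ e0] exI[of _ "{e0}"]) auto
    next
      case True
      let ?X = "component S e0"
      have XS: "?X \<subseteq> S" using True by (rule component_subset)
      obtain p0 where p0: "p0 \<in> P" using False by blast
      then have "p0 \<in> C - S" using r less.prems(1) unfolding P_def S_def by blast
      then obtain y z where yz: "y \<in> ?X" "z \<in> C - ?X" "adj y z"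
        using crossing_edge[OF less.prems(2), of ?X] XS in_component[of e0 S] unfolding S_def by blast
      then have "z \<notin> S" using component_closed[of y S e0 z] True by blast
      then obtain p where "p \<in> P" "adj (r p) z" using yz unfolding S_def by blast
      moreover have "conn (insert z ?X)" using conn_insert[of ?X y z] yz by simp
      ultimately show ?thesis
        using yz XS by (intro bexI[of _ p] bexI[of _ z] exI[of _ "insert z ?X"]) (auto simp: S_def)
    qed
    then obtain p e W where pe: "p \<in> P" "e \<in> C" "W \<subseteq> C" "conn W" "e0 \<in> W" "e \<in> W" "adj (r p) e" "W - {e} \<subseteq> S"
      by blast
    define y where "y = r p"
    have yE: "y \<in> r ` E" and yx: "y \<notin> ball R x"
      using pe(1) less.prems(1) unfolding y_def P_def by blast+
    \<comment> \<open>The components of \<open>C\<close> without the star of \<open>y\<close> that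
      touch no neighbour of \<open>x\<close> in \<open>E\<close>.\<close>
    define Hid where "Hid = {u\<in>C - {v. adj y v}.
      \<forall>v\<in>component (C - {v. adj y v}) u. \<not> (\<exists>h\<in>E. adj x h \<and> adj h v)}"
    \<comment> \<open>The set \<open>W\<close> with \<open>g\<close> links \<open>x\<close> to
      \<open>y\<close>, and \<open>C\<close> links \<open>y\<close> to \<open>r f\<close>. As the
      triple is not asteroidal, \<open>x\<close> and \<open>r f\<close> are not linked past
      \<open>y\<close>, so the component of \<open>f\<close> cannot touch the star of
      \<open>x\<close>.\<close>
    have behind: "f \<in> Hid" if f: "f \<in> P" "r f \<notin> ball R y" for f
    proof -
      let ?z = "r f"
      have zE: "?z \<in> r ` E" and zx: "?z \<notin> ball R x" and fC: "f \<in> C" "f \<in> E"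
        using f less.prems(1) unfolding P_def by blast+
      note ncn = far_no_common_nbr[OF zx R] far_no_common_nbr[OF yx R] far_no_common_nbr[OF f(2) R]
      have "link E x y ?z"
        unfolding link_def
      proof (intro exI conjI)
        show "conn (insert g W)"
          using conn_insert[OF pe(4,5), of g] less.prems adj_sym by blast
        show "insert g W \<subseteq> E" using pe less.prems by blast
        show "\<exists>v\<in>insert g W. adj x v" using less.prems by blast
        show "\<exists>v\<in>insert g W. adj y v" using pe unfolding y_def by blast
        show "\<forall>v\<in>insert g W. \<not> adj (r f) v"
        proof
          fix v assume "v \<in> insert g W"
          then consider "v = g" | "v = e" | "v \<in> S" using pe by blast
          then show "\<not> adj (r f) v"
            using ncn less.prems pe f unfolding S_def y_def by cases blast+
        qed
      qed
      moreover have "link E y ?z x"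
        unfolding link_def
      proof (intro exI conjI)
        show "C \<subseteq> E" "conn C" "\<forall>v\<in>C. \<not> adj x v" using less.prems by auto
        show "\<exists>v\<in>C. adj y v" "\<exists>v\<in>C. adj (r f) v" using pe fC r unfolding y_def by blast+
      qed
      ultimately have nolink: "\<not> link E x ?z y"
        using no_ast[OF less.prems(4) yE zE] yx zx f(2) unfolding asteroidal_def by blast
      have fy: "f \<in> C - {v. adj y v}" using ncn(3) r fC by blast
      let ?K = "component (C - {v. adj y v}) f"
      have KC: "?K \<subseteq> C - {v. adj y v}" using fy by (rule component_subset)
      have False if vh: "v \<in> ?K" "h \<in> E" "adj x h" "adj h v" for v h
      proof -
        have "conn (insert h ?K)" using conn_insert[of ?K v h] vh adj_sym by simp
        moreover have "\<forall>v\<in>insert h ?K. \<not> adj y v" using KC ncn(2) vh by blast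
        moreover have "insert h ?K \<subseteq> E" using KC vh less.prems by blast
        moreover have "\<exists>v\<in>insert h ?K. adj (r f) v" using r[OF fC(2)] in_component by blast
        ultimately show False using nolink vh(3) unfolding link_def by blast
      qed
      then show ?thesis using fy unfolding Hid_def by blast
    qed
    show ?thesis
    proof (rule layer[of y Hid e])
      show "r e \<in> ball R x \<union> ball R y" if "e \<in> C - Hid" for e
        using behind that unfolding P_def by blast
      show "component (C - {v. adj y v}) u \<subseteq> Hid" if u: "u \<in> Hid" for u
      proof
        fix v assume v: "v \<in> component (C - {v. adj y v}) u"
        have "u \<in> C - {v. adj y v}" using u unfolding Hid_def by blast
        from component_subset[OF this] v have "v \<in> C - {v. adj y v}" by (rule subsetD)
        then show "v \<in> Hid" using u component_eq[OF v] unfolding Hid_def by simp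
      qed
      show "\<not> adj h u" if "u \<in> Hid" "h \<in> E" "adj x h" for u h
        using that unfolding Hid_def by (metis (no_types, lifting) in_component mem_Collect_eq)
    qed (use yE pe y_def in \<open>auto simp: Hid_def\<close>)
  qed
qed

text \<open>If there were none, fix the centre \<open>x = r d\<close>. Its star needs only
  \<open>t\<close> colours, and each component of the rest of \<open>E\<close> needs at most
  \<open>4 * t\<close> by \<open>two_palettes\<close>.\<close>

lemma asteroidal_triple_exists:
  assumes E: "conn E" "\<not> colourable_set E (5 * t)"
    and r: "\<And>e. e \<in> E \<Longrightarrow> adj (r e) e"
    and balls: "\<And>v. colourable_set (ball (Suc R) v) t" and R: "2 \<le> R"
  shows "\<exists>x\<in>r ` E. \<exists>y\<in>r ` E. \<exists>z\<in>r ` E. asteroidal R E x y z"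
proof (rule ccontr)
  assume neg: "\<not> ?thesis"
  have "E \<noteq> {}" using E(2) unfolding colourable_set_def by auto
  then obtain d where d: "d \<in> E" by blast
  let ?x = "r d"
  let ?S = "{v\<in>E. adj ?x v}"
  have "colourable_set (E - ?S) (4 * t)"
  proof (rule colourable_set_components)
    fix u assume u: "u \<in> E - ?S"
    let ?C = "component (E - ?S) u"
    have CE: "?C \<subseteq> E - ?S" using u by (rule component_subset)
    have "d \<in> E - ?C" using CE d r by blast
    then obtain e g where eg: "e \<in> ?C" "g \<in> E - ?C" "adj e g"
      using crossing_edge[OF E(1), of ?C] CE in_component[of u "E - ?S"] by blast
    then have g: "adj ?x g" using component_closed[of e "E - ?S" u g] u by blast
    have "\<exists>c. (\<forall>u\<in>?C. c u < 4 * t) \<and> (\<forall>u\<in>?C. \<forall>v\<in>?C. adj u v \<longrightarrow> c u \<noteq> c v) \<and>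
       (\<forall>u\<in>?C. (\<exists>h\<in>E. adj ?x h \<and> adj h u) \<longrightarrow> (c u < 2 * t \<longleftrightarrow> True))"
      by (rule two_palettes[of r E R t _ _ g e])
        (use neg r balls R CE eg g d adj_sym in auto)
    then show "colourable_set ?C (4 * t)" unfolding colourable_set_def by blast
  qed
  moreover have "?S \<subseteq> ball (Suc R) ?x" using ball_mono[of 1 "Suc R" ?x] by auto
  then have "colourable_set ?S t" using balls colourable_set_mono by blast
  ultimately have "colourable_set ((E - ?S) \<union> ?S) (4 * t + t)" by (rule colourable_set_Un)
  moreover have "(E - ?S) \<union> ?S = E" by blast
  ultimately show False using E(2) by simp
qed

end

section \<open>Pigeonhole and greedy selection of indices\<close>

lemma large_fibre:
  assumes "finite K" "finite B" "f ` K \<subseteq> B" "card B * s \<le> card K" "K \<noteq> {}"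
  shows "\<exists>y. s \<le> card {k\<in>K. f k = y}"
proof (rule ccontr)
  assume neg: "\<not> ?thesis"
  have B: "card B > 0" using assms by (metis card_gt_0_iff image_is_empty subset_empty)
  have "K \<subseteq> (\<Union>y\<in>B. {k\<in>K. f k = y})" using assms(3) by blast
  then have "card K \<le> card (\<Union>y\<in>B. {k\<in>K. f k = y})"
    using assms(1,2) by (intro card_mono) auto
  also have "\<dots> \<le> (\<Sum>y\<in>B. card {k\<in>K. f k = y})" using assms(2) by (rule card_UN_le)
  also have "\<dots> \<le> (\<Sum>y\<in>B. s - 1)"
  proof (intro sum_mono)
    fix y
    have "card {k\<in>K. f k = y} < s" using neg by (meson not_le)
    then show "card {k\<in>K. f k = y} \<le> s - 1" by simp
  qed
  finally have "card K \<le> card B * (s - 1)" by simp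
  moreover have "s \<noteq> 0" using neg by auto
  ultimately show False using assms(4) B by (cases s) auto
qed

text \<open>Greedy choice: take the least index and discard it with its at most \<open>q\<close>
  successors under \<open>T\<close>, at a cost of \<open>Suc q\<close> indices. Taking the least one
  ensures that it is the smaller member of every later pair.\<close>

lemma independent_indices:
  fixes S :: "nat set"
  assumes "finite S" "p * Suc q \<le> card S" "\<And>i. i \<in> S \<Longrightarrow> card {j\<in>S. (i, j) \<in> T} \<le> q"
  shows "\<exists>K\<subseteq>S. card K = p \<and> (\<forall>i\<in>K. \<forall>j\<in>K. i < j \<longrightarrow> (i, j) \<notin> T)"
  using assms
proof (induction p arbitrary: S)
  case 0
  then show ?case by (intro exI[of _ "{}"]) auto
next
  case (Suc p)
  then have ne: "S \<noteq> {}" by auto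
  define m where "m = Min S"
  have m: "m \<in> S" "\<And>j. j \<in> S \<Longrightarrow> m \<le> j" unfolding m_def using Suc.prems ne by auto
  define S' where "S' = S - {m} - {j\<in>S. (m, j) \<in> T}"
  have "card S - 1 - q \<le> card S'"
  proof -
    have "card (S - {m}) - card {j\<in>S. (m, j) \<in> T} \<le> card S'"
      unfolding S'_def by (rule diff_card_le_card_Diff) (use Suc.prems in auto)
    then show ?thesis using Suc.prems(3)[OF m(1)] Suc.prems(1) m(1) by (simp add: card_Diff_singleton)
  qed
  then have "p * Suc q \<le> card S'" using Suc.prems(2) by simp
  moreover have "finite S'" using Suc.prems(1) unfolding S'_def by simp
  moreover have "card {j\<in>S'. (i, j) \<in> T} \<le> q" if "i \<in> S'" for i
  proof -
    have "card {j\<in>S'. (i, j) \<in> T} \<le> card {j\<in>S. (i, j) \<in> T}"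
      using Suc.prems(1) by (intro card_mono) (auto simp: S'_def)
    then show ?thesis using Suc.prems(3)[of i] that unfolding S'_def by auto
  qed
  ultimately obtain K where K: "K \<subseteq> S'" "card K = p" "\<forall>i\<in>K. \<forall>j\<in>K. i < j \<longrightarrow> (i, j) \<notin> T"
    using Suc.IH by blast
  have "finite K" "m \<notin> K" using K(1) \<open>finite S'\<close> finite_subset unfolding S'_def by auto
  then have "card (insert m K) = Suc p" using K(2) by simp
  moreover have "insert m K \<subseteq> S" using K(1) m unfolding S'_def by auto
  moreover have "(i, j) \<notin> T" if ij: "i \<in> insert m K" "j \<in> insert m K" "i < j" for i j
  proof (cases "i = m")
    case True
    then show ?thesis using ij K(1) unfolding S'_def by auto
  next
    case False
    have "j \<noteq> m"
    proof
      assume "j = m"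
      moreover have "m \<le> i" using ij(1) m K(1) unfolding S'_def by auto
      ultimately show False using ij(3) by simp
    qed
    then show ?thesis using ij K(3) False by auto
  qed
  ultimately show ?case by (intro exI[of _ "insert m K"]) auto
qed

context simple_graph begin

section \<open>Levellings\<close>

text \<open>If all levels of a breadth-first search of \<open>D\<close> were
  \<open>k\<close>-colourable, alternating palettes would colour \<open>D\<close> with
  \<open>2 * k\<close> colours. For a level \<open>i\<close> that is not, \<open>D'\<close> is a
  component of it, \<open>M\<close> is the level just below, and \<open>U\<close> is everything
  below \<open>M\<close>.\<close>

lemma levelling:
  assumes D: "conn D" "\<not> colourable_set D (2 * k)" and balls: "\<And>v. colourable_set (ball 1 v) k"
  obtains U M D' where "U \<subseteq> D" "M \<subseteq> D" "D' \<subseteq> D" "conn U" "conn D'" "\<not> colourable_set D' k"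
    "anticomplete U D'" "U \<inter> M = {}" "M \<inter> D' = {}"
    "\<forall>d\<in>D'. \<exists>r\<in>M. adj r d" "\<forall>r\<in>M. \<exists>u\<in>U. adj r u"
    "\<forall>a\<in>M. \<forall>b\<in>M. \<forall>c\<in>M. (\<forall>v. \<not> (adj a v \<and> adj b v)) \<longrightarrow> (\<forall>v. \<not> (adj a v \<and> adj c v)) \<longrightarrow> link U b c a"
proof -
  have "D \<noteq> {}" using D(2) unfolding colourable_set_def by auto
  then obtain z where z: "z \<in> D" by blast
  \<comment> \<open>Breadth-first search inside \<open>D\<close>: distances from \<open>z\<close>
    are measured in \<open>D\<close>, not in the whole graph.\<close>
  define B where "B = rec_nat {z} (\<lambda>_ X. X \<union> {v\<in>D. \<exists>u\<in>X. adj u v})"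
  have B0: "B 0 = {z}" and BS: "B (Suc i) = B i \<union> {v\<in>D. \<exists>u\<in>B i. adj u v}" for i
    unfolding B_def by simp_all
  have BD: "B i \<subseteq> D" for i by (induction i) (use z in \<open>auto simp: B0 BS\<close>)
  have Bmono: "i \<le> j \<Longrightarrow> B i \<subseteq> B j" for i j by (induction j) (auto simp: BS le_Suc_eq)
  have connB: "conn (B i)" for i
  proof -
    have "\<forall>v\<in>B i. reach (B i) z v"
    proof (induction i)
      case (Suc i)
      have old: "reach (B (Suc i)) z v" if "v \<in> B i" for v
        using Suc that reach_mono[of "B i" z v "B (Suc i)"] BS by blast
      show ?case
      proof
        fix v assume v: "v \<in> B (Suc i)"
        show "reach (B (Suc i)) z v"
        proof (cases "v \<in> B i")
          case False
          then obtain u where u: "u \<in> B i" "adj u v" using v BS by auto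
          then have "reach (B (Suc i)) u v" using v BS by (intro reach_adj) auto
          then show ?thesis using old[OF u(1)] reach_trans by blast
        qed (rule old)
      qed
    qed (simp add: B0)
    then show ?thesis unfolding conn_def by (meson reach_sym reach_trans)
  qed
  have all: "\<exists>i. v \<in> B i" if v: "v \<in> D" for v
  proof -
    have "reach D z v" using D(1) z v unfolding conn_def by blast
    then show ?thesis unfolding reach_def
    proof (induction rule: rtranclp_induct)
      case base
      then show ?case using B0 by blast
    next
      case (step u w)
      then obtain i where "u \<in> B i" by blast
      then have "w \<in> B (Suc i)" using step BS by blast
      then show ?case ..
    qed
  qed
  define h where "h v = (LEAST i. v \<in> B i)" for v
  have hB: "v \<in> B (h v)" if "v \<in> D" for v using all[OF that] unfolding h_def by (rule LeastI_ex)
  have h_le: "h v \<le> i" if "v \<in> B i" for v i using that unfolding h_def by (rule Least_le)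
  have h_iff: "v \<in> B i \<longleftrightarrow> h v \<le> i" if "v \<in> D" for v i
    using hB[OF that] h_le Bmono by blast
  have step: "h y \<le> Suc (h x)" if "x \<in> D" "y \<in> D" "adj x y" for x y
    using hB[OF that(1)] that h_le[of y "Suc (h x)"] BS by blast
  have "\<exists>i. \<not> colourable_set {x\<in>D. h x = i} k"
    using colourable_set_levels[of D h k] D(2) step adj_sym by blast
  then obtain i where i: "\<not> colourable_set {x\<in>D. h x = i} k" by blast
  \<comment> \<open>Levels 0 and 1 lie in the ball of radius 1 about \<open>z\<close>, so there are
    two levels below level \<open>i\<close>.\<close>
  have "\<not> i \<le> 1"
  proof
    assume "i \<le> 1"
    then have "{x\<in>D. h x = i} \<subseteq> B 1" using h_iff by auto
    also have "\<dots> \<subseteq> ball 1 z" using BS[of 0] B0 by auto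
    finally show False using i balls colourable_set_mono by blast
  qed
  then obtain j where j: "i = Suc (Suc j)" by (metis One_nat_def Suc_le_eq not0_implies_Suc not_less_eq_eq le0)
  obtain D' where D': "D' \<subseteq> {x\<in>D. h x = i}" "conn D'" "\<not> colourable_set D' k"
    using large_component[OF i] by blast
  define M where "M = {x\<in>D. h x = Suc j}"
  have par: "\<exists>u\<in>B m. adj v u \<and> h u = m" if v: "v \<in> D" "h v = Suc m" for v m
  proof -
    have "v \<in> B (Suc m)" "v \<notin> B m" using h_iff[OF v(1)] v(2) by auto
    then obtain u where u: "u \<in> B m" "adj u v" using BS by blast
    then have "h u \<le> m" "u \<in> D" using h_iff BD by blast+
    moreover have "Suc m \<le> Suc (h u)" using step[of u v] u v \<open>u \<in> D\<close> by simp
    ultimately show ?thesis using u adj_sym by force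
  qed
  have nonadj: "\<not> adj v u" if "v \<in> D" "u \<in> B m" "Suc m < h v" for u v m
  proof
    assume "adj v u"
    then have "v \<in> B (Suc m)" using that adj_sym BS by blast
    then show False using h_le that(3) by force
  qed
  show thesis
  proof (rule that[of "B j" M D'])
    show "B j \<subseteq> D" "M \<subseteq> D" "D' \<subseteq> D" "conn (B j)" "conn D'" "\<not> colourable_set D' k"
      using BD connB D' unfolding M_def by blast+
    show "anticomplete (B j) D'"
    proof -
      have "x \<notin> D'" "\<not> adj x y" if "x \<in> B j" "y \<in> D'" for x y
        using that D' j h_le[of x j] nonadj[of y x j] adj_sym by fastforce+
      moreover have "x \<notin> D'" if "x \<in> B j" for x using that D' j h_le[of x j] by fastforce
      ultimately show ?thesis unfolding anticomplete_def by blast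
    qed
    show "B j \<inter> M = {}" using h_le unfolding M_def by fastforce
    show "M \<inter> D' = {}" using D' j unfolding M_def by auto
    show "\<forall>d\<in>D'. \<exists>r\<in>M. adj r d"
    proof
      fix d assume "d \<in> D'"
      then obtain u where "u \<in> B (Suc j)" "adj d u" "h u = Suc j" using par[of d "Suc j"] D' j by blast
      then show "\<exists>r\<in>M. adj r d" using BD adj_sym unfolding M_def by blast
    qed
    show "\<forall>r\<in>M. \<exists>u\<in>B j. adj r u" using par unfolding M_def by blast
    show "\<forall>a\<in>M. \<forall>b\<in>M. \<forall>c\<in>M. (\<forall>v. \<not> (adj a v \<and> adj b v)) \<longrightarrow> (\<forall>v. \<not> (adj a v \<and> adj c v)) \<longrightarrow> link (B j) b c a"
    proof (intro ballI impI)
      fix a b c assume abc: "a \<in> M" "b \<in> M" "c \<in> M"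
        and ab: "\<forall>v. \<not> (adj a v \<and> adj b v)" and ac: "\<forall>v. \<not> (adj a v \<and> adj c v)"
      obtain u v where u: "u \<in> B j" "adj b u" "h u = j" and v: "v \<in> B j" "adj c v" "h v = j"
        using par abc unfolding M_def by blast
      show "link (B j) b c a"
      proof (cases j)
        case 0
        then have "u = v" using u v B0 by simp
        then show ?thesis unfolding link_def using u v ab by (intro exI[of _ "{u}"]) auto
      next
        case (Suc m)
        \<comment> \<open>\<open>B m\<close> is two levels below \<open>a\<close> and has no edges
          to it. Of the connecting set only \<open>u\<close> and \<open>v\<close> could meet the
          star of \<open>a\<close>, and they are neighbours of \<open>b\<close> and
          \<open>c\<close>.\<close>
        have "\<exists>u'\<in>B m. adj u u'" "\<exists>v'\<in>B m. adj v v'"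
          using par[of u m] par[of v m] u v BD Suc by blast+
        then obtain u' v' where uv': "u' \<in> B m" "adj u' u" "v' \<in> B m" "adj v' v" using adj_sym by blast
        have "conn (insert v (insert u (B m)))"
          using conn_insert[OF conn_insert[OF connB uv'(1,2)] _ uv'(4)] uv'(3) by blast
        moreover have "insert v (insert u (B m)) \<subseteq> B j" using u v Suc BS by auto
        moreover have "\<not> adj a x" if "x \<in> insert v (insert u (B m))" for x
          using that ab ac u v nonadj[of a x m] abc(1) Suc unfolding M_def by auto
        ultimately show ?thesis unfolding link_def
          using u(2) v(2) by (intro exI[of _ "insert v (insert u (B m))"]) blast
      qed
    qed
  qed
qed

text \<open>Models \<open>n\<close> levellings, each taken inside the top set of the one before. For
  \<open>i < j\<close> the sets \<open>M i\<close> and \<open>U j\<close> are merely disjoint; the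
  edges between them are what the later dichotomy is about.\<close>

definition tower :: "nat \<Rightarrow> (nat \<Rightarrow> 'a set) \<Rightarrow> (nat \<Rightarrow> 'a set) \<Rightarrow> 'a set \<Rightarrow> bool" where
  "tower n U M E \<longleftrightarrow>
     (\<forall>i<n. conn (U i) \<and> anticomplete (U i) E \<and> U i \<inter> M i = {} \<and> M i \<inter> E = {} \<and>
        (\<forall>d\<in>E. \<exists>r\<in>M i. adj r d) \<and> (\<forall>r\<in>M i. \<exists>u\<in>U i. adj r u) \<and>
        (\<forall>a\<in>M i. \<forall>b\<in>M i. \<forall>c\<in>M i. (\<forall>v. \<not> (adj a v \<and> adj b v)) \<longrightarrow> (\<forall>v. \<not> (adj a v \<and> adj c v)) \<longrightarrow>
           link (U i) b c a)) \<and>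
     (\<forall>i<n. \<forall>j<n. i < j \<longrightarrow> anticomplete (U i) (U j) \<and> anticomplete (U i) (M j) \<and>
        M i \<inter> U j = {} \<and> M i \<inter> M j = {})"

lemma anticomplete_mono: "anticomplete X Y \<Longrightarrow> X' \<subseteq> X \<Longrightarrow> Y' \<subseteq> Y \<Longrightarrow> anticomplete X' Y'"
  unfolding anticomplete_def by blast

lemma anticomplete_commute: "anticomplete X Y \<longleftrightarrow> anticomplete Y X"
  unfolding anticomplete_def using adj_sym by blast

text \<open>One application of \<open>levelling\<close> halves the number of colours guaranteed to
  be insufficient; the remaining \<open>n\<close> levellings are built inside its top set
  \<open>D'\<close>.\<close>

lemma tower_exists:
  assumes balls: "\<And>v. colourable_set (ball 1 v) k" and k: "k > 0"
  shows "conn D \<Longrightarrow> \<not> colourable_set D (2 ^ n * k) \<Longrightarrow>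
    \<exists>U M E. tower n U M E \<and> E \<subseteq> D \<and> (\<forall>i<n. U i \<subseteq> D \<and> M i \<subseteq> D) \<and> conn E \<and> \<not> colourable_set E k"
proof (induction n arbitrary: D)
  case 0
  then show ?case by (auto simp: tower_def)
next
  case (Suc n)
  have b: "colourable_set (ball 1 v) (2 ^ n * k)" for v
    by (rule colourable_set_mono[OF balls[of v]]) auto
  obtain U0 M0 D' where *: "U0 \<subseteq> D" "M0 \<subseteq> D" "D' \<subseteq> D" "conn U0" "conn D'" "\<not> colourable_set D' (2 ^ n * k)"
    "anticomplete U0 D'" "U0 \<inter> M0 = {}" "M0 \<inter> D' = {}"
    "\<forall>d\<in>D'. \<exists>r\<in>M0. adj r d" "\<forall>r\<in>M0. \<exists>u\<in>U0. adj r u"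
    "\<forall>a\<in>M0. \<forall>b\<in>M0. \<forall>c\<in>M0. (\<forall>v. \<not> (adj a v \<and> adj b v)) \<longrightarrow> (\<forall>v. \<not> (adj a v \<and> adj c v)) \<longrightarrow> link U0 b c a"
    by (rule levelling[OF Suc.prems(1) _ b]) (use Suc.prems(2) in \<open>simp add: mult.assoc\<close>)
  obtain U M E where IH: "tower n U M E" "E \<subseteq> D'" "\<forall>i<n. U i \<subseteq> D' \<and> M i \<subseteq> D'" "conn E" "\<not> colourable_set E k"
    using Suc.IH[OF *(5,6)] by blast
  \<comment> \<open>The outermost levelling receives index 0 and the inner ones shift up by
    one.\<close>
  define U' where "U' = case_nat U0 U"
  define M' where "M' = case_nat M0 M"
  have s: "U' 0 = U0" "M' 0 = M0" "\<And>i. U' (Suc i) = U i" "\<And>i. M' (Suc i) = M i"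
    unfolding U'_def M'_def by simp_all
  have anti: "anticomplete U0 X" "M0 \<inter> X = {}" if "X \<subseteq> D'" for X
    using anticomplete_mono[OF *(7)] that *(9) by blast+
  have "tower (Suc n) U' M' E"
    unfolding tower_def
  proof (intro conjI)
    show "\<forall>i<Suc n. conn (U' i) \<and> anticomplete (U' i) E \<and> U' i \<inter> M' i = {} \<and> M' i \<inter> E = {} \<and>
        (\<forall>d\<in>E. \<exists>r\<in>M' i. adj r d) \<and> (\<forall>r\<in>M' i. \<exists>u\<in>U' i. adj r u) \<and>
        (\<forall>a\<in>M' i. \<forall>b\<in>M' i. \<forall>c\<in>M' i. (\<forall>v. \<not> (adj a v \<and> adj b v)) \<longrightarrow> (\<forall>v. \<not> (adj a v \<and> adj c v)) \<longrightarrow>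
           link (U' i) b c a)"
    proof (intro allI impI)
      fix i assume i: "i < Suc n"
      show "conn (U' i) \<and> anticomplete (U' i) E \<and> U' i \<inter> M' i = {} \<and> M' i \<inter> E = {} \<and>
        (\<forall>d\<in>E. \<exists>r\<in>M' i. adj r d) \<and> (\<forall>r\<in>M' i. \<exists>u\<in>U' i. adj r u) \<and>
        (\<forall>a\<in>M' i. \<forall>b\<in>M' i. \<forall>c\<in>M' i. (\<forall>v. \<not> (adj a v \<and> adj b v)) \<longrightarrow> (\<forall>v. \<not> (adj a v \<and> adj c v)) \<longrightarrow>
           link (U' i) b c a)"
      proof (cases i)
        case 0
        show ?thesis unfolding 0 s by (intro conjI *(4,8,11,12) anti IH(2)) (use *(10) IH(2) in blast)
      next
        case (Suc m)
        show ?thesis unfolding Suc s using IH(1) i Suc unfolding tower_def by simp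
      qed
    qed
    show "\<forall>i<Suc n. \<forall>j<Suc n. i < j \<longrightarrow> anticomplete (U' i) (U' j) \<and> anticomplete (U' i) (M' j) \<and>
        M' i \<inter> U' j = {} \<and> M' i \<inter> M' j = {}"
    proof (intro allI impI)
      fix i j assume ij: "i < Suc n" "j < Suc n" "i < j"
      then obtain m where j: "j = Suc m" "m < n" by (cases j) auto
      show "anticomplete (U' i) (U' j) \<and> anticomplete (U' i) (M' j) \<and> M' i \<inter> U' j = {} \<and> M' i \<inter> M' j = {}"
      proof (cases i)
        case 0
        show ?thesis unfolding 0 j s by (intro conjI anti) (use IH(3) j in auto)
      next
        case (Suc l)
        show ?thesis unfolding Suc j s using IH(1) ij Suc j unfolding tower_def by simp
      qed
    qed
  qed
  moreover have "\<forall>i<Suc n. U' i \<subseteq> D \<and> M' i \<subseteq> D"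
  proof (intro allI impI)
    fix i assume "i < Suc n"
    moreover have "U i \<subseteq> D \<and> M i \<subseteq> D" if "i < n" for i
      using IH(3) *(3) that order_trans by meson
    ultimately show "U' i \<subseteq> D \<and> M' i \<subseteq> D" using *(1,2) by (cases i) (simp_all add: s)
  qed
  ultimately show ?case using IH *(3) by blast
qed

section \<open>Many connectors between three points\<close>

text \<open>Beyond a link, \<open>W\<close> has to miss the three points, so that it can hold the
  inside of a path.\<close>

definition connector :: "'a set \<Rightarrow> 'a \<Rightarrow> 'a \<Rightarrow> 'a \<Rightarrow> bool" where
  "connector W a b c \<longleftrightarrow> conn W \<and> W \<inter> {a, b, c} = {} \<and>
     (\<exists>v\<in>W. adj a v) \<and> (\<exists>v\<in>W. adj b v) \<and> (\<forall>v\<in>W. \<not> adj c v)"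

text \<open>The indices form three blocks, for the pairs \<open>a, b\<close> and \<open>a, c\<close>
  and \<open>b, c\<close>; the last has length 2 because of the two parallel edges. A single
  sequence lets anticompleteness be stated across all blocks at once.\<close>

definition connected_triple :: "nat \<Rightarrow> nat \<Rightarrow> bool" where
  "connected_triple R N \<longleftrightarrow> (\<exists>a b c W. b \<notin> ball R a \<and> c \<notin> ball R a \<and> c \<notin> ball R b \<and>
     (\<forall>i<N. connector (W i) a b c) \<and> (\<forall>i\<in>{N..<2*N}. connector (W i) a c b) \<and>
     (\<forall>i\<in>{2*N..<2*N+2}. connector (W i) b c a) \<and>
     (\<forall>i<2*N+2. \<forall>j<2*N+2. i \<noteq> j \<longrightarrow> anticomplete (W i) (W j)))"

lemma connector_of_link:
  assumes "link X a b c" "a \<notin> X" "b \<notin> X" "c \<notin> X"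
  shows "\<exists>W\<subseteq>X. connector W a b c"
  using assms unfolding link_def connector_def by blast

lemma enumerate_subset:
  fixes J :: "nat set"
  assumes "N \<le> card J" "finite J"
  obtains f where "inj_on f {..<N}" "f ` {..<N} \<subseteq> J"
proof -
  obtain J' where J': "J' \<subseteq> J" "card J' = N" "finite J'"
    using obtain_subset_with_card_n[OF assms(1)] by blast
  obtain f where "bij_betw f {0..<N} J'" using ex_bij_betw_nat_finite[OF J'(3)] J'(2) by blast
  then show thesis using that[of f] J'(1) by (simp add: bij_betw_def atLeast0LessThan)
qed

text \<open>
  The points \<open>a, b, c\<close> are parents in one levelling \<open>l\<close>. The sets \<open>U j\<close> with \<open>j \<in> J\<close> give the
  many paths at \<open>a\<close>; of the two paths between \<open>b\<close> and \<open>c\<close>, one runs through the levelling \<open>l\<close>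
  itself and the other through the set \<open>E\<close> at the top of the tower.
\<close>

lemma connected_triple_of_hub:
  assumes tower: "tower n U M E" and l: "l < n" and E': "E' \<subseteq> E"
    and abc: "a \<in> M l" "b \<in> M l" "c \<in> M l"
    and far: "b \<notin> ball R a" "c \<notin> ball R a" "c \<notin> ball R b" and R: "2 \<le> R"
    and J: "finite J" "2 * N \<le> card J" "\<And>j. j \<in> J \<Longrightarrow> l < j \<and> j < n \<and> link (U j) a b c \<and> link (U j) a c b"
    and top: "link E' b c a"
  shows "connected_triple R N"
proof -
  note ncn = far_no_common_nbr[OF far(1) R] far_no_common_nbr[OF far(2) R] far_no_common_nbr[OF far(3) R]
  obtain f where f: "inj_on f {..<2*N}" "f ` {..<2*N} \<subseteq> J"
    using enumerate_subset[OF J(2,1)] by blast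
  \<comment> \<open>\<open>X i\<close> is the set inside which the connector with index
    \<open>i\<close> will be found.\<close>
  define X where "X i = (if i < 2 * N then U (f i) else if i = 2 * N then U l else E')" for i
  have fi: "l < f i" "f i < n" "link (U (f i)) a b c" "link (U (f i)) a c b" if "i < 2 * N" for i
    using f(2) J(3) that by blast+
  have notin: "x \<notin> X i" if x: "x \<in> M l" "i < 2 * N + 2" for x i
  proof -
    consider "i < 2 * N" | "i = 2 * N" | "i = 2 * N + 1" using x(2) by linarith
    then show ?thesis
    proof cases
      case 1
      then have "M l \<inter> U (f i) = {}" using tower l fi unfolding tower_def by blast
      then show ?thesis using 1 that(1) unfolding X_def by auto
    next
      case 2
      have "U l \<inter> M l = {}" using tower l unfolding tower_def by blast
      then show ?thesis using 2 that(1) unfolding X_def by auto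
    next
      case 3
      have "M l \<inter> E = {}" using tower l unfolding tower_def by blast
      then show ?thesis using 3 that(1) E' unfolding X_def by auto
    qed
  qed
  have X: "link (X i) a b c" "link (X i) a c b" if "i < 2 * N" for i
    using fi that unfolding X_def by auto
  \<comment> \<open>This is the last clause of \<open>levelling\<close>: within their own levelling,
    two parents are linked past any third that shares no neighbour with them.\<close>
  have Ul: "link (U l) b c a" using tower l abc ncn unfolding tower_def by blast
  have Y: "link (X i) b c a" if "i \<in> {2*N..<2*N+2}" for i
    using Ul top that unfolding X_def by auto
  define good where "good i W \<longleftrightarrow> W \<subseteq> X i \<and> (i < N \<longrightarrow> connector W a b c) \<and>
     (i \<in> {N..<2*N} \<longrightarrow> connector W a c b) \<and> (i \<in> {2*N..<2*N+2} \<longrightarrow> connector W b c a)" for i W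
  have "\<exists>W. good i W" if i: "i < 2 * N + 2" for i
  proof -
    consider "i < N" | "i \<in> {N..<2*N}" | "i \<in> {2*N..<2*N+2}" using i by fastforce
    then show ?thesis
    proof cases
      case 1
      then have "link (X i) a b c" using X by simp
      from connector_of_link[OF this] show ?thesis
        using notin[OF abc(1) i] notin[OF abc(2) i] notin[OF abc(3) i] 1 unfolding good_def by auto
    next
      case 2
      then have "link (X i) a c b" using X by simp
      from connector_of_link[OF this] show ?thesis
        using notin[OF abc(1) i] notin[OF abc(2) i] notin[OF abc(3) i] 2 unfolding good_def by auto
    next
      case 3
      from connector_of_link[OF Y[OF this]] show ?thesis
        using notin[OF abc(1) i] notin[OF abc(2) i] notin[OF abc(3) i] 3 unfolding good_def by auto
    qed
  qed
  then obtain W where W: "\<forall>i<2*N+2. good i (W i)" by metis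
  have anti: "anticomplete (X i) (X j)" if ij: "i < 2 * N + 2" "j < 2 * N + 2" "i < j" for i j
  proof -
    have UE: "anticomplete (U i) E'" if "i < n" for i
      using tower that anticomplete_mono[OF _ order_refl E'] unfolding tower_def by blast
    have UU: "anticomplete (U i) (U j)" if "i < n" "j < n" "i \<noteq> j" for i j
      using tower that anticomplete_commute unfolding tower_def by (metis linorder_neqE_nat)
    consider "j < 2 * N" | "i < 2 * N" "j = 2 * N" | "i < 2 * N + 1" "j = 2 * N + 1" using ij by fastforce
    then show ?thesis
    proof cases
      case 1
      then have "f i \<noteq> f j" using f(1) ij(3) unfolding inj_on_def by fastforce
      then show ?thesis using UU fi ij 1 unfolding X_def by simp
    next
      case 2
      then show ?thesis using UU[of "f i" l] fi[of i] l unfolding X_def by simp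
    next
      case 3
      then show ?thesis using UE fi[of i] l unfolding X_def by auto
    qed
  qed
  have "anticomplete (W i) (W j)" if ij: "i < 2 * N + 2" "j < 2 * N + 2" "i \<noteq> j" for i j
  proof -
    have "W i \<subseteq> X i" "W j \<subseteq> X j" using W ij unfolding good_def by blast+
    then show ?thesis
      using anti[of i j] anti[of j i] ij anticomplete_mono anticomplete_commute by (metis linorder_neqE_nat)
  qed
  then show ?thesis unfolding connected_triple_def using far W unfolding good_def
    by (intro exI[of _ a] exI[of _ b] exI[of _ c] exI[of _ W]) auto
qed

text \<open>For each \<open>j \<in> J\<close> some point is linked to both others within
  \<open>U j\<close>, so one point is such a hub for a third of \<open>J\<close>. All three links
  through \<open>E'\<close> are at hand because it is not known beforehand which point this will
  be.\<close>

lemma connected_triple_of_asteroidal: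
  assumes tower: "tower n U M E" and l: "l < n" and E': "E' \<subseteq> E"
    and abc: "a \<in> M l" "b \<in> M l" "c \<in> M l"
    and ast: "asteroidal R E' a b c" and R: "2 \<le> R"
    and J: "finite J" "6 * N \<le> card J" "\<And>j. j \<in> J \<Longrightarrow> l < j \<and> j < n"
    and nbrs: "\<And>j x. j \<in> J \<Longrightarrow> x \<in> {a, b, c} \<Longrightarrow> \<exists>u\<in>U j. adj x u"
  shows "connected_triple R N"
proof -
  have far: "b \<notin> ball R a" "c \<notin> ball R a" "c \<notin> ball R b"
    and top: "link E' a b c" "link E' a c b" "link E' b c a"
    using ast unfolding asteroidal_def by blast+
  \<comment> \<open>Distance is symmetric; the six orientations allow any of the three points to
    become the hub.\<close>
  note far' = far far[THEN contrapos_nn, OF ball_sym]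
  define A where "A x y z = {j\<in>J. link (U j) x y z \<and> link (U j) x z y}" for x y z
  have "J \<subseteq> A a b c \<union> A b a c \<union> A c a b"
  proof
    fix j assume j: "j \<in> J"
    have "conn (U j)" using tower J(3)[OF j] unfolding tower_def by blast
    then have "link (U j) a b c \<and> link (U j) a c b \<or> link (U j) b a c \<and> link (U j) b c a \<or>
        link (U j) c a b \<and> link (U j) c b a"
      using nbrs[OF j] far_no_common_nbr[OF _ R] far by (intro link_two_of_three) auto
    then show "j \<in> A a b c \<union> A b a c \<union> A c a b" using j unfolding A_def by blast
  qed
  then have "card J \<le> card (A a b c \<union> A b a c \<union> A c a b)"
    using J(1) unfolding A_def by (intro card_mono) auto
  also have "\<dots> \<le> card (A a b c) + card (A b a c) + card (A c a b)"
    using card_Un_le[of "A a b c \<union> A b a c" "A c a b"] card_Un_le[of "A a b c" "A b a c"] by linarith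
  finally consider "2 * N \<le> card (A a b c)" | "2 * N \<le> card (A b a c)" | "2 * N \<le> card (A c a b)"
    using J(2) by fastforce
  then show ?thesis
  proof cases
    case 1
    show ?thesis
      by (rule connected_triple_of_hub[OF tower l E' abc far' (1,2,3) R _ 1])
        (use J top in \<open>auto simp: A_def\<close>)
  next
    case 2
    show ?thesis
      by (rule connected_triple_of_hub[OF tower l E' abc(2,1,3) far'(4,3,2) R _ 2])
        (use J top in \<open>auto simp: A_def\<close>)
  next
    case 3
    show ?thesis
      by (rule connected_triple_of_hub[OF tower l E' abc(3,1,2) far'(5,6,1) R _ 3])
        (use J top in \<open>auto simp: A_def\<close>)
  qed
qed

text \<open>
  Within \<open>K\<close>, no parent has a neighbour in the set \<open>U j\<close> of a later levelling. So the vertices of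
  \<open>E\<close> themselves can serve as branch vertices, each leg leaving through the parent.
\<close>

lemma connected_triple_of_independent:
  assumes tower: "tower n U M E" and abc: "a \<in> E" "b \<in> E" "c \<in> E"
    and far: "b \<notin> ball R a" "c \<notin> ball R a" "c \<notin> ball R b" and R: "3 \<le> R"
    and r: "\<And>i x. i < n \<Longrightarrow> x \<in> E \<Longrightarrow> r i x \<in> M i \<and> adj (r i x) x"
    and K: "finite K" "K \<subseteq> {..<n}" "t ^ 3 * (2 * N + 2) \<le> card K" "K \<noteq> {}"
    and indep: "\<And>i j x. i \<in> K \<Longrightarrow> j \<in> K \<Longrightarrow> i < j \<Longrightarrow> x \<in> {a, b, c} \<Longrightarrow> \<forall>u\<in>U j. \<not> adj (r i x) u"
    and balls: "\<And>v. colourable_set (ball 1 v) t"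
  shows "connected_triple R N"
proof -
  let ?X = "{a, b, c}"
  have far': "y \<notin> ball R x" if "x \<in> ?X" "y \<in> ?X" "x \<noteq> y" for x y
    using far that ball_sym by blast
  have "\<forall>v. \<exists>d. (\<forall>x\<in>ball 1 v. d x < t) \<and> (\<forall>x\<in>ball 1 v. \<forall>y\<in>ball 1 v. adj x y \<longrightarrow> d x \<noteq> (d y :: nat))"
    using balls unfolding colourable_set_def by blast
  then obtain d where d: "\<forall>v. (\<forall>x\<in>ball 1 v. d v x < t) \<and>
      (\<forall>x\<in>ball 1 v. \<forall>y\<in>ball 1 v. adj x y \<longrightarrow> d v x \<noteq> (d v y :: nat))" by (rule choice[THEN exE])
  \<comment> \<open>\<open>d v\<close> colours the ball of radius 1 about \<open>v\<close>. Indices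
    with equal triples have, for each of \<open>a\<close>, \<open>b\<close>, \<open>c\<close>,
    equally coloured and thus non-adjacent parents. There are at most \<open>t ^ 3\<close>
    triples.\<close>
  define g where "g i = (d a (r i a), d b (r i b), d c (r i c))" for i
  have rball: "r i x \<in> ball 1 x" if "i < n" "x \<in> E" for i x
    using r[OF that] adj_sym by auto
  have dr: "d x (r i x) < t" if "i \<in> K" "x \<in> E" for i x
    using d rball[of i x] that K(2) by blast
  have "g ` K \<subseteq> {..<t} \<times> {..<t} \<times> {..<t}"
    using dr abc unfolding g_def by auto
  moreover have "card ({..<t} \<times> {..<t} \<times> {..<t}) * (2 * N + 2) \<le> card K"
    using K(3) by (simp add: power3_eq_cube)
  ultimately obtain col where col: "2 * N + 2 \<le> card {i\<in>K. g i = col}"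
    using large_fibre[of K "{..<t} \<times> {..<t} \<times> {..<t}" g "2 * N + 2"] K by auto
  obtain f where f: "inj_on f {..<2*N+2}" "f ` {..<2*N+2} \<subseteq> {i\<in>K. g i = col}"
    using enumerate_subset[OF col] K(1) by auto
  have fK: "f i \<in> K" "f i < n" "g (f i) = col" if "i < 2 * N + 2" for i
    using f(2) K(2) that by blast+
  have stable: "\<not> adj (r i x) (r j x)" if "i \<in> K" "j \<in> K" "g i = g j" "x \<in> ?X" for i j x
  proof
    assume "adj (r i x) (r j x)"
    then have "d x (r i x) \<noteq> d x (r j x)" using d rball that abc K(2) by blast
    then show False using that(3,4) unfolding g_def by auto
  qed
  \<comment> \<open>The branch vertices lie in \<open>E\<close>, which has no edges to
    \<open>U j\<close>, so their parents have to be part of the connector.\<close>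
  define leg where "leg j x y = U j \<union> {r j x, r j y}" for j x y
  have leg: "connector (leg j x y) x y z"
    if j: "j < n" and xyz: "x \<in> ?X" "y \<in> ?X" "z \<in> ?X" "x \<noteq> z" "y \<noteq> z" for j x y z
  proof -
    have E: "x \<in> E" "y \<in> E" "z \<in> E" using xyz abc by blast+
    have tw: "conn (U j)" "anticomplete (U j) E" "M j \<inter> E = {}" "\<forall>p\<in>M j. \<exists>u\<in>U j. adj p u"
      using tower j unfolding tower_def by simp_all
    note UE = tw(2,3)
    obtain u where u: "u \<in> U j" "adj (r j x) u" using tw(4) r[OF j E(1)] by blast
    obtain v where v: "v \<in> U j" "adj (r j y) v" using tw(4) r[OF j E(2)] by blast
    have "conn (insert (r j y) (insert (r j x) (U j)))"
      by (rule conn_insert[OF conn_insert[OF tw(1) u(1) adj_sym[OF u(2)]] _ adj_sym[OF v(2)]])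
        (use v(1) in blast)
    moreover have "leg j x y = insert (r j y) (insert (r j x) (U j))" unfolding leg_def by blast
    moreover have "w \<notin> leg j x y" if "w \<in> E" for w
    proof -
      have "r j x \<in> M j" "r j y \<in> M j" using r[OF j E(1)] r[OF j E(2)] by simp_all
      then show ?thesis using UE that unfolding leg_def anticomplete_def by auto
    qed
    then have "leg j x y \<inter> {x, y, z} = {}" using E by auto
    moreover have "\<not> adj z v" if "v \<in> leg j x y" for v
    proof -
      have "\<not> adj z (r j x)" "\<not> adj z (r j y)"
        using far_no_common_nbr[OF far'[of x z]] far_no_common_nbr[OF far'[of y z]] R
          r[OF j E(1)] r[OF j E(2)] xyz adj_sym by (metis Suc_leD numeral_2_eq_2 numeral_3_eq_3)+
      moreover have "\<not> adj z u" if "u \<in> U j" for u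
        using UE(1) E(3) that adj_sym unfolding anticomplete_def by blast
      ultimately show ?thesis using that unfolding leg_def by blast
    qed
    moreover have "\<exists>v\<in>leg j x y. adj x v" "\<exists>v\<in>leg j x y. adj y v"
      using adj_sym r[OF j E(1)] r[OF j E(2)] unfolding leg_def by blast+
    ultimately show ?thesis unfolding connector_def by simp
  qed
  have anti: "anticomplete (leg i x y) (leg j x' y')"
    if ij: "i \<in> K" "j \<in> K" "i < j" "g i = g j" and x: "x \<in> ?X" "y \<in> ?X" "x' \<in> ?X" "y' \<in> ?X" for i j x y x' y'
  proof -
    have n: "i < n" "j < n" using ij K(2) by blast+
    have t: "anticomplete (U i) (U j)" "anticomplete (U i) (M j)" "M i \<inter> U j = {}" "M i \<inter> M j = {}"
      using tower n ij(3) unfolding tower_def by blast+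
    \<comment> \<open>Parents of one point are non-adjacent by their colours. Adjacent parents of
      two different points would join these by a walk of length 3, against
      \<open>3 \<le> R\<close>.\<close>
    have rr: "\<not> adj (r i p) (r j q)" if pq: "p \<in> ?X" "q \<in> ?X" for p q
    proof (cases "p = q")
      case True
      then show ?thesis using stable ij pq by blast
    next
      case False
      show ?thesis
      proof
        assume "adj (r i p) (r j q)"
        moreover have "adj p (r i p)" "adj (r j q) q" using r n pq abc adj_sym by blast+
        ultimately have "q \<in> ball 3 p" by (auto simp: numeral_3_eq_3)
        then show False using far'[OF pq False] ball_mono[OF R] by blast
      qed
    qed
    have m: "r i p \<in> M i" "r j p \<in> M j" if "p \<in> ?X" for p using r n abc that by blast+
    have U: "anticomplete (U i) {r j x', r j y'}"
      by (rule anticomplete_mono[OF t(2)]) (use m x in auto)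
    have one: "anticomplete {r i p} (U j)" if "p \<in> ?X" for p
    proof -
      have "r i p \<notin> U j" using t(3) m(1)[OF that] by auto
      then show ?thesis using indep[OF ij(1-3) that] unfolding anticomplete_def by auto
    qed
    have two: "anticomplete {r i p} {r j q}" if "p \<in> ?X" "q \<in> ?X" for p q
    proof -
      have "r i p \<noteq> r j q" using t(4) m(1)[OF that(1)] m(2)[OF that(2)] by auto
      then show ?thesis using rr[OF that] unfolding anticomplete_def by auto
    qed
    note facts = U t(1) one[OF x(1)] one[OF x(2)]
      two[OF x(1,3)] two[OF x(1,4)] two[OF x(2,3)] two[OF x(2,4)]
    show ?thesis using facts unfolding leg_def anticomplete_def by auto
  qed
  define W where "W i = (if i < N then leg (f i) a b else if i < 2 * N then leg (f i) a c else leg (f i) b c)" for i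
  have ne: "a \<noteq> b" "a \<noteq> c" "b \<noteq> c" using far by auto
  have "anticomplete (W i) (W j)" if ij: "i < 2 * N + 2" "j < 2 * N + 2" "i \<noteq> j" for i j
  proof -
    have Wleg: "\<exists>x\<in>?X. \<exists>y\<in>?X. W i = leg (f i) x y" for i unfolding W_def by simp
    obtain x y where x: "x \<in> ?X" "y \<in> ?X" "W i = leg (f i) x y" using Wleg by blast
    obtain x' y' where x': "x' \<in> ?X" "y' \<in> ?X" "W j = leg (f j) x' y'" using Wleg by blast
    have "f i \<noteq> f j" using f(1) ij unfolding inj_on_def by auto
    then consider "f i < f j" | "f j < f i" by fastforce
    then show ?thesis
      using anti fK[OF ij(1)] fK[OF ij(2)] x x' anticomplete_commute by cases metis+
  qed
  moreover have "\<forall>i<N. connector (W i) a b c" "\<forall>i\<in>{N..<2*N}. connector (W i) a c b"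
    "\<forall>i\<in>{2*N..<2*N+2}. connector (W i) b c a"
    using leg fK ne unfolding W_def by auto
  ultimately show ?thesis unfolding connected_triple_def using far by blast
qed

text \<open>The bound pays for three things: \<open>2 ^ n\<close> for a tower of \<open>n\<close>
  levellings, \<open>2 ^ (n * n)\<close> for the possible types of a vertex of \<open>E\<close>, and
  \<open>5 * t\<close> for an asteroidal triple among vertices of one type.\<close>

lemma connected_triple_exists:
  assumes balls: "\<And>v. colourable_set (ball (Suc R) v) t" and R: "3 \<le> R"
    and n: "n = t ^ 3 * (2 * N + 2) * Suc (6 * N)"
    and V: "\<not> colourable_set V (2 ^ n * (2 ^ (n * n) * (5 * t)))"
  shows "connected_triple R N"
proof -
  define k where "k = 2 ^ (n * n) * (5 * t)"
  obtain v0 where "v0 \<in> V" using V unfolding colourable_set_def by auto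
  have t: "t > 0" using balls[of v0] in_ball_self unfolding colourable_set_def by (metis gr0I not_less0)
  then have k: "k > 0" "t \<le> k" unfolding k_def by (auto intro: order_trans[OF _ mult_le_mono1[of 1]])
  have b1: "colourable_set (ball 1 v) t" for v
    by (rule colourable_set_mono[OF balls]) (use ball_mono[of 1 "Suc R"] in auto)
  then have bk: "colourable_set (ball 1 v) k" for v using colourable_set_mono k(2) by blast
  obtain D where D: "conn D" "\<not> colourable_set D (2 ^ n * k)"
    using large_component[OF V] unfolding k_def by blast
  obtain U M E where tower: "tower n U M E" and E: "\<not> colourable_set E k"
    using tower_exists[OF bk k(1) D] by blast
  define r where "r i x = (SOME p. p \<in> M i \<and> adj p x)" for i x
  have r: "r i x \<in> M i \<and> adj (r i x) x" if i: "i < n" and x: "x \<in> E" for i x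
  proof -
    have "\<forall>d\<in>E. \<exists>p\<in>M i. adj p d" using tower i unfolding tower_def by simp
    from this[rule_format, OF x] obtain p where p: "p \<in> M i \<and> adj p x" by blast
    show ?thesis unfolding r_def by (rule someI[where P = "\<lambda>p. p \<in> M i \<and> adj p x"]) (rule p)
  qed
  \<comment> \<open>The type records the pairs of levellings for which the parent of
    \<open>x\<close> in the earlier one has a neighbour in the connected set of the later
    one.\<close>
  define ty where "ty x = {(i, j). i < j \<and> j < n \<and> (\<exists>u\<in>U j. adj (r i x) u)}" for x
  have "\<exists>T. \<not> colourable_set {x\<in>E. ty x = T} (5 * t)"
  proof (rule ccontr)
    assume "\<not> ?thesis"
    then have "colourable_set E (card (Pow ({..<n} \<times> {..<n})) * (5 * t))"
      by (intro colourable_set_fibres[of _ ty]) (auto simp: ty_def)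
    then show False using E unfolding k_def by (simp add: card_Pow card_cartesian_product)
  qed
  then obtain T where "\<not> colourable_set {x\<in>E. ty x = T} (5 * t)" by blast
  then obtain E' where E': "E' \<subseteq> {x\<in>E. ty x = T}" "conn E'" "\<not> colourable_set E' (5 * t)"
    by (rule large_component)
  show ?thesis
  proof (cases "\<exists>l<n. 6 * N \<le> card {j\<in>{..<n}. (l, j) \<in> T}")
    case True
    then obtain l where l: "l < n" "6 * N \<le> card {j\<in>{..<n}. (l, j) \<in> T}" by blast
    have "\<exists>x\<in>r l ` E'. \<exists>y\<in>r l ` E'. \<exists>z\<in>r l ` E'. asteroidal R E' x y z"
      by (rule asteroidal_triple_exists[OF E'(2,3) _ balls]) (use E'(1) r l R in auto)
    then obtain a b c where abc: "a \<in> E'" "b \<in> E'" "c \<in> E'" "asteroidal R E' (r l a) (r l b) (r l c)"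
      by blast
    have ty: "(l, j) \<in> ty x" if "x \<in> {a, b, c}" "(l, j) \<in> T" for x j
      using that abc E'(1) by blast
    show ?thesis
    proof (rule connected_triple_of_asteroidal[OF tower l(1) _ _ _ _ abc(4) _ _ l(2)])
      show "\<exists>u\<in>U j. adj x u" if "j \<in> {j\<in>{..<n}. (l, j) \<in> T}" "x \<in> {r l a, r l b, r l c}" for j x
        using that ty[of a j] ty[of b j] ty[of c j] unfolding ty_def by auto
      show "l < j \<and> j < n" if "j \<in> {j\<in>{..<n}. (l, j) \<in> T}" for j
        using that ty[of a j] unfolding ty_def by auto
    qed (use R E'(1) abc r l in auto)
  next
    case False
    \<comment> \<open>Every index now has fewer than \<open>6 * N\<close> successors, and
      \<open>n\<close> was chosen so that greedy selection with \<open>q = 6 * N\<close> leaves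
      enough indices.\<close>
    have "\<exists>K\<subseteq>{..<n}. card K = t ^ 3 * (2 * N + 2) \<and> (\<forall>i\<in>K. \<forall>j\<in>K. i < j \<longrightarrow> (i, j) \<notin> T)"
      using False by (intro independent_indices[where q = "6 * N"]) (auto simp: n not_le intro: less_imp_le)
    then obtain K where K: "K \<subseteq> {..<n}" "card K = t ^ 3 * (2 * N + 2)" "\<forall>i\<in>K. \<forall>j\<in>K. i < j \<longrightarrow> (i, j) \<notin> T"
      by blast
    have bR: "colourable_set (ball R v) t" for v
      by (rule colourable_set_mono[OF balls]) (use ball_mono[of R "Suc R"] in auto)
    obtain a where a: "a \<in> E'" using E'(3) unfolding colourable_set_def by auto
    \<comment> \<open>Balls of radius \<open>R\<close> need at most \<open>t\<close> colours each,
      so neither one nor two of them can cover \<open>E'\<close>.\<close>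
    have "\<not> E' \<subseteq> ball R a" using E'(3) colourable_set_mono[OF bR, of E' a "5 * t"] by auto
    then obtain b where b: "b \<in> E'" "b \<notin> ball R a" by blast
    have "\<not> E' \<subseteq> ball R a \<union> ball R b"
      using E'(3) colourable_set_mono[OF colourable_set_Un[OF bR bR], of E' a b "5 * t"] by auto
    then obtain c where c: "c \<in> E'" "c \<notin> ball R a" "c \<notin> ball R b" by blast
    show ?thesis
    proof (rule connected_triple_of_independent[OF tower _ _ _ b(2) c(2,3) R r])
      show "\<forall>u\<in>U j. \<not> adj (r i x) u" if "i \<in> K" "j \<in> K" "i < j" "x \<in> {a, b, c}" for i j x
      proof -
        have "(i, j) \<notin> ty x" using that K(3) E'(1) a b c by blast
        then show ?thesis using that K(1) unfolding ty_def by auto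
      qed
      show "finite K" using K(1) finite_subset by blast
      show "K \<noteq> {}" using K(2) t by auto
    qed (use a b c E'(1) K b1 in auto)
  qed
qed

end

section \<open>Subdivisions with longer paths\<close>

lemma set_vwalk_arcs: "set (vwalk_arcs p) = {(p ! k, p ! Suc k) |k. Suc k < length p}"
proof (induction p rule: vwalk_arcs.induct)
  case (3 x y xs)
  have "{((x # y # xs) ! k, (x # y # xs) ! Suc k) |k. Suc k < length (x # y # xs)} =
    insert (x, y) {((y # xs) ! k, (y # xs) ! Suc k) |k. Suc k < length (y # xs)}" (is "?L = ?R")
  proof
    show "?L \<subseteq> ?R"
    proof
      fix e assume "e \<in> ?L"
      then obtain k where k: "e = ((x # y # xs) ! k, (x # y # xs) ! Suc k)" "Suc k < length (x # y # xs)"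
        by blast
      then show "e \<in> ?R" by (cases k) auto
    qed
    show "?R \<subseteq> ?L"
    proof
      fix e assume "e \<in> ?R"
      then consider "e = (x, y)" | k where "e = ((y # xs) ! k, (y # xs) ! Suc k)" "Suc k < length (y # xs)"
        by blast
      then show "e \<in> ?L"
      proof cases
        case 1
        then show ?thesis by (intro CollectI exI[of _ 0]) auto
      next
        case 2
        then show ?thesis by (intro CollectI exI[of _ "Suc k"]) auto
      qed
    qed
  qed
  then show ?case using 3 by simp
qed auto

lemma symcl_iff: "(x, y) \<in> symcl A \<longleftrightarrow> (x, y) \<in> A \<or> (y, x) \<in> A"
  unfolding symcl_def by auto

definition consecutive :: "'a list \<Rightarrow> 'a \<Rightarrow> 'a \<Rightarrow> bool" where
  "consecutive p x y \<longleftrightarrow> (\<exists>k. Suc k < length p \<and> (x = p ! k \<and> y = p ! Suc k \<or> x = p ! Suc k \<and> y = p ! k))"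

lemma in_symcl_vwalk_arcs: "(x, y) \<in> symcl (set (vwalk_arcs p)) \<longleftrightarrow> consecutive p x y"
  unfolding symcl_iff set_vwalk_arcs consecutive_def by blast

lemma induced_pair_graph:
  assumes G: "pair_graph G" and S: "S \<subseteq> pverts G"
  defines "K \<equiv> \<lparr>pverts = S, parcs = {(x, y) \<in> parcs G. x \<in> S \<and> y \<in> S}\<rparr>"
  shows "pair_graph K" "iso_induced K G"
proof -
  interpret G: pair_graph G by fact
  show K: "pair_graph K"
  proof
    show "finite (pverts K)" unfolding K_def using finite_subset[OF S G.pair_finite_verts] by simp
    have "parcs K \<subseteq> parcs G" unfolding K_def by auto
    then show "finite (parcs K)" using G.pair_finite_arcs finite_subset by blast
    show "symmetric (with_proj K)"
      unfolding symmetric_def K_def using G.arcs_symmetric by (auto intro!: symI)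
  qed (use G.no_loops' in \<open>auto simp: K_def\<close>)
  interpret K: pair_graph K by fact
  have "induced_subgraph (with_proj K) (with_proj G)"
    unfolding induced_subgraph_def subgraph_def compatible_def
    using S K.wf_digraph_axioms G.wf_digraph_axioms by (auto simp: K_def)
  moreover have "digraph_iso (with_proj K) (with_proj K)"
    unfolding digraph_iso_def K.digraph_isomorphism_def
    by (intro exI[of _ "\<lparr>iso_verts = id, iso_arcs = id, iso_head = snd, iso_tail = fst\<rparr>"])
      (use K.wf_digraph_axioms in \<open>auto simp: app_iso_def with_proj_def\<close>)
  ultimately show "iso_induced K G" unfolding iso_induced_def by blast
qed

text \<open>
  \<open>B\<close> is the set of branch vertices of \<open>J\<close>, and \<open>P e\<close> its path for the edge \<open>e\<close>. If \<open>G\<close> has paths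
  \<open>Q e\<close> in the same arrangement, each at least as long as \<open>P e\<close>, then all edges of \<open>P e\<close> but the
  last are mapped to single edges of \<open>Q e\<close>, and the last one to the rest of \<open>Q e\<close>.
\<close>

locale longer_paths =
  fixes J G :: "'a pair_pre_digraph" and B :: "'a set" and ME :: "'e set"
    and P Q :: "'e \<Rightarrow> 'a list" and g :: "'a \<Rightarrow> 'a"
  assumes J: "pair_graph J" and G: "pair_graph G"
    and P_distinct: "e \<in> ME \<Longrightarrow> distinct (P e)" and P_length: "e \<in> ME \<Longrightarrow> 2 \<le> length (P e)"
    and P_branch: "e \<in> ME \<Longrightarrow> set (P e) \<inter> B = {hd (P e), last (P e)}"
    and P_disjoint: "e \<in> ME \<Longrightarrow> f \<in> ME \<Longrightarrow> e \<noteq> f \<Longrightarrow> set (P e) \<inter> set (P f) \<subseteq> B"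
    and P_arcs: "e \<in> ME \<Longrightarrow> f \<in> ME \<Longrightarrow> e \<noteq> f \<Longrightarrow>
      symcl (set (vwalk_arcs (P e))) \<inter> symcl (set (vwalk_arcs (P f))) = {}"
    and J_verts: "pverts J = B \<union> (\<Union>e\<in>ME. set (P e))"
    and J_arcs: "parcs J = (\<Union>e\<in>ME. symcl (set (vwalk_arcs (P e))))"
    and Q_distinct: "e \<in> ME \<Longrightarrow> distinct (Q e)" and Q_length: "e \<in> ME \<Longrightarrow> length (P e) \<le> length (Q e)"
    and Q_hd: "e \<in> ME \<Longrightarrow> hd (Q e) = g (hd (P e))" and Q_last: "e \<in> ME \<Longrightarrow> last (Q e) = g (last (P e))"
    and Q_branch: "e \<in> ME \<Longrightarrow> set (Q e) \<inter> g ` B \<subseteq> {hd (Q e), last (Q e)}"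
    and Q_disjoint: "e \<in> ME \<Longrightarrow> f \<in> ME \<Longrightarrow> e \<noteq> f \<Longrightarrow> set (Q e) \<inter> set (Q f) \<subseteq> g ` B"
    and g_inj: "inj_on g B"
    and Q_verts: "g ` B \<union> (\<Union>e\<in>ME. set (Q e)) \<subseteq> pverts G"
    and Q_induced: "x \<in> g ` B \<union> (\<Union>e\<in>ME. set (Q e)) \<Longrightarrow> y \<in> g ` B \<union> (\<Union>e\<in>ME. set (Q e)) \<Longrightarrow>
      (x, y) \<in> parcs G \<longleftrightarrow> (\<exists>e\<in>ME. consecutive (Q e) x y)"
begin

definition pos :: "'e \<Rightarrow> nat \<Rightarrow> nat" where
  "pos e i = (if Suc i < length (P e) then i else length (Q e) - 1)"

text \<open>The choice is forced: a vertex of \<open>J\<close> outside \<open>B\<close> lies on one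
  path only, at one position. Branch vertices may lie on many paths and are placed by
  \<open>g\<close>.\<close>

definition emb :: "'a \<Rightarrow> 'a" where
  "emb w = (if w \<in> B then g w else SOME x. \<exists>e\<in>ME. \<exists>i<length (P e). w = P e ! i \<and> x = Q e ! pos e i)"

text \<open>The part of \<open>Q e\<close> that replaces the edge number \<open>i\<close> of
  \<open>P e\<close>; it is a single edge unless that edge is the last one.\<close>

definition seg :: "'e \<Rightarrow> nat \<Rightarrow> 'a list" where
  "seg e i = map ((!) (Q e)) [pos e i..<Suc (pos e (Suc i))]"

lemma pos_less: "e \<in> ME \<Longrightarrow> i < length (P e) \<Longrightarrow> pos e i < length (Q e)"
  using Q_length[of e] unfolding pos_def by auto

lemma pos_strict_mono: "e \<in> ME \<Longrightarrow> i < j \<Longrightarrow> j < length (P e) \<Longrightarrow> pos e i < pos e j"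
  using Q_length[of e] unfolding pos_def by auto

lemma pos_mono: "e \<in> ME \<Longrightarrow> i \<le> j \<Longrightarrow> j < length (P e) \<Longrightarrow> pos e i \<le> pos e j"
  using pos_strict_mono[of e i j] by (cases "i = j") auto

lemma P_nth_eq: "e \<in> ME \<Longrightarrow> i < length (P e) \<Longrightarrow> j < length (P e) \<Longrightarrow> P e ! i = P e ! j \<longleftrightarrow> i = j"
  using P_distinct nth_eq_iff_index_eq by blast

lemma Q_nth_eq: "e \<in> ME \<Longrightarrow> i < length (Q e) \<Longrightarrow> j < length (Q e) \<Longrightarrow> Q e ! i = Q e ! j \<longleftrightarrow> i = j"
  using Q_distinct nth_eq_iff_index_eq by blast

lemma P_ne: "e \<in> ME \<Longrightarrow> P e \<noteq> []" and Q_ne: "e \<in> ME \<Longrightarrow> Q e \<noteq> []"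
  using P_length[of e] Q_length[of e] by auto

lemma pos_ends: "e \<in> ME \<Longrightarrow> pos e 0 = 0" "e \<in> ME \<Longrightarrow> pos e (length (P e) - 1) = length (Q e) - 1"
  using P_length[of e] unfolding pos_def by auto

lemma emb_nth:
  assumes e: "e \<in> ME" and i: "i < length (P e)" shows "emb (P e ! i) = Q e ! pos e i"
proof (cases "P e ! i \<in> B")
  case True
  then have "P e ! i \<in> {hd (P e), last (P e)}" using P_branch[OF e] i nth_mem by blast
  then have "P e ! i = P e ! 0 \<or> P e ! i = P e ! (length (P e) - 1)"
    using P_ne[OF e] by (simp add: hd_conv_nth last_conv_nth)
  then have "i = 0 \<or> i = length (P e) - 1"
    using P_nth_eq[OF e i, of 0] P_nth_eq[OF e i, of "length (P e) - 1"] i by (metis diff_less length_greater_0_conv P_ne e zero_less_one)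
  then show ?thesis
  proof
    assume i0: "i = 0"
    have "emb (P e ! i) = g (hd (P e))" using True P_ne[OF e] unfolding emb_def i0 by (simp add: hd_conv_nth)
    also have "\<dots> = Q e ! 0" using Q_hd[OF e] Q_ne[OF e] by (simp add: hd_conv_nth)
    finally show ?thesis using pos_ends(1)[OF e] i0 by simp
  next
    assume il: "i = length (P e) - 1"
    have "emb (P e ! i) = g (last (P e))" using True P_ne[OF e] unfolding emb_def il by (simp add: last_conv_nth)
    also have "\<dots> = Q e ! (length (Q e) - 1)" using Q_last[OF e] Q_ne[OF e] by (simp add: last_conv_nth)
    finally show ?thesis using pos_ends(2)[OF e] il by simp
  qed
next
  case False
  have "x = Q e ! pos e i" if x: "\<exists>f\<in>ME. \<exists>j<length (P f). P e ! i = P f ! j \<and> x = Q f ! pos f j" for x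
  proof -
    obtain f j where fj: "f \<in> ME" "j < length (P f)" "P e ! i = P f ! j" "x = Q f ! pos f j" using x by blast
    have "f = e"
    proof (rule ccontr)
      assume "f \<noteq> e"
      then have "P e ! i \<in> B" using P_disjoint[OF e fj(1)] i fj(2,3) nth_mem by (metis IntI subsetD)
      then show False using False by simp
    qed
    then show ?thesis using fj P_nth_eq[OF e i, of j] by simp
  qed
  moreover have "\<exists>f\<in>ME. \<exists>j<length (P f). P e ! i = P f ! j \<and> Q e ! pos e i = Q f ! pos f j" using e i by blast
  ultimately show ?thesis using False unfolding emb_def
    by (smt (verit, ccfv_SIG) someI)
qed

lemma emb_branch: "w \<in> B \<Longrightarrow> emb w = g w"
  unfolding emb_def by simp

lemma J_vert_cases:
  assumes "w \<in> pverts J"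
  obtains "w \<in> B" | e i where "e \<in> ME" "i < length (P e)" "w = P e ! i"
  using assms unfolding J_verts by (auto simp: in_set_conv_nth)

lemma Q_branch_nth:
  assumes e: "e \<in> ME" and k: "k < length (Q e)" and B: "Q e ! k \<in> g ` B"
  shows "k = 0 \<or> k = length (Q e) - 1"
proof -
  have "Q e ! k \<in> {hd (Q e), last (Q e)}" using Q_branch[OF e] k B nth_mem by blast
  then have "Q e ! k = Q e ! 0 \<or> Q e ! k = Q e ! (length (Q e) - 1)"
    using Q_ne[OF e] by (simp add: hd_conv_nth last_conv_nth)
  then show ?thesis
    using Q_nth_eq[OF e k, of 0] Q_nth_eq[OF e k, of "length (Q e) - 1"] k by fastforce
qed

lemma emb_on_Q:
  assumes e: "e \<in> ME" and k: "k < length (Q e)" and w: "w \<in> pverts J" "emb w = Q e ! k"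
  shows "\<exists>i<length (P e). w = P e ! i \<and> k = pos e i"
proof -
  have branch: ?thesis if wB: "w \<in> B"
  proof -
    have "Q e ! k \<in> g ` B" using wB w(2)[symmetric] emb_branch by simp
    with Q_branch_nth[OF e k] consider "k = 0" | "k = length (Q e) - 1" by blast
    then obtain i where i: "i < length (P e)" "k = pos e i" "P e ! i \<in> {hd (P e), last (P e)}"
    proof cases
      case 1
      show thesis by (rule that[of 0]) (use P_ne[OF e] 1 pos_ends[OF e] in \<open>auto simp: hd_conv_nth\<close>)
    next
      case 2
      show thesis by (rule that[of "length (P e) - 1"])
        (use P_ne[OF e] 2 pos_ends[OF e] in \<open>auto simp: last_conv_nth\<close>)
    qed
    then have iB: "P e ! i \<in> B" using P_branch[OF e] by blast
    have "g w = g (P e ! i)" using emb_nth[OF e i(1)] i(2) w(2) emb_branch wB iB by simp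
    then have "w = P e ! i" using g_inj wB iB unfolding inj_on_def by blast
    then show ?thesis using i by blast
  qed
  show ?thesis
    using w(1)
  proof (cases rule: J_vert_cases)
    case 1
    then show ?thesis by (rule branch)
  next
    case (2 f j)
    show ?thesis
    proof (cases "f = e")
      case True
      then have "Q e ! pos e j = Q e ! k" using emb_nth 2 w(2) by simp
      then have "pos e j = k" using Q_nth_eq[OF e pos_less[OF e] k] 2 True by blast
      then show ?thesis using 2 True by blast
    next
      case False
      have eq: "Q e ! k = Q f ! pos f j" using emb_nth 2 w(2) by simp
      have "pos f j < length (Q f)" using pos_less 2 by blast
      then have "Q f ! pos f j \<in> set (Q e) \<inter> set (Q f)" using eq k nth_mem by (metis IntI)
      then have gB: "Q f ! pos f j \<in> g ` B" using Q_disjoint[OF e 2(1)] False by blast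
      then have "pos f j = 0 \<or> pos f j = length (Q f) - 1"
        using Q_branch_nth[OF 2(1)] pos_less 2 by blast
      then have "j = 0 \<or> j = length (P f) - 1"
        using pos_strict_mono[OF 2(1), of 0 j] pos_strict_mono[OF 2(1), of j "length (P f) - 1"]
          pos_ends[OF 2(1)] 2(2) by (metis Suc_pred' gr_zeroI less_Suc_eq less_irrefl_nat less_nat_zero_code)
      then have "w \<in> {hd (P f), last (P f)}"
        using 2 P_ne[OF 2(1)] by (auto simp: hd_conv_nth last_conv_nth)
      then have "w \<in> B" using P_branch[OF 2(1)] by blast
      then show ?thesis by (rule branch)
    qed
  qed
qed

lemma inj_emb: "inj_on emb (pverts J)"
proof (rule inj_onI)
  fix v w assume vw: "v \<in> pverts J" "w \<in> pverts J" "emb v = emb w"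
  have *: "v = w" if v: "e \<in> ME" "i < length (P e)" "v = P e ! i" "w \<in> pverts J" "emb v = emb w" for e i v w
  proof -
    have "emb w = Q e ! pos e i" using emb_nth v by simp
    then obtain j where j: "j < length (P e)" "w = P e ! j" "pos e i = pos e j"
      using emb_on_Q[OF v(1) pos_less[OF v(1,2)] v(4)] by blast
    have "i = j" using pos_strict_mono[OF v(1), of i j] pos_strict_mono[OF v(1), of j i] j v(2)
      by (metis less_irrefl_nat linorder_neqE_nat)
    then show ?thesis using j v by simp
  qed
  show "v = w"
    using vw(1)
  proof (cases rule: J_vert_cases)
    case v: 1
    show ?thesis
      using vw(2)
    proof (cases rule: J_vert_cases)
      case 1
      then show ?thesis using v vw(3) emb_branch g_inj unfolding inj_on_def by simp
    next
      case (2 e i)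
      then show ?thesis using *[of e i w v] vw by simp
    qed
  next
    case (2 e i)
    then show ?thesis using *[of e i v w] vw by simp
  qed
qed

section \<open>The segments of the long paths that replace the edges of \<open>J\<close>\<close>

lemma set_seg: "set (seg e i) = {Q e ! k |k. pos e i \<le> k \<and> k \<le> pos e (Suc i)}"
  unfolding seg_def by (auto simp: less_Suc_eq_le)

lemma seg_nth: "pos e i + k \<le> pos e (Suc i) \<Longrightarrow> seg e i ! k = Q e ! (pos e i + k)"
  unfolding seg_def by (simp add: nth_upt del: upt_Suc)

lemma length_seg: "length (seg e i) = Suc (pos e (Suc i)) - pos e i"
  unfolding seg_def by (simp del: upt_Suc)

lemma consecutive_seg:
  assumes "e \<in> ME" "Suc i < length (P e)"
  shows "consecutive (seg e i) x y \<longleftrightarrow> (\<exists>k. pos e i \<le> k \<and> k < pos e (Suc i) \<and>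
    (x = Q e ! k \<and> y = Q e ! Suc k \<or> x = Q e ! Suc k \<and> y = Q e ! k))"
proof -
  have le: "pos e i < pos e (Suc i)" using pos_strict_mono assms by simp
  show ?thesis
  proof
    assume "consecutive (seg e i) x y"
    then obtain k where k: "Suc k < length (seg e i)"
      "x = seg e i ! k \<and> y = seg e i ! Suc k \<or> x = seg e i ! Suc k \<and> y = seg e i ! k"
      unfolding consecutive_def by blast
    then show "\<exists>k. pos e i \<le> k \<and> k < pos e (Suc i) \<and> (x = Q e ! k \<and> y = Q e ! Suc k \<or> x = Q e ! Suc k \<and> y = Q e ! k)"
      using le seg_nth[of e i k] seg_nth[of e i "Suc k"] by (intro exI[of _ "pos e i + k"]) (auto simp: length_seg)
  next
    assume "\<exists>k. pos e i \<le> k \<and> k < pos e (Suc i) \<and> (x = Q e ! k \<and> y = Q e ! Suc k \<or> x = Q e ! Suc k \<and> y = Q e ! k)"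
    then obtain k where k: "pos e i \<le> k" "k < pos e (Suc i)"
      "x = Q e ! k \<and> y = Q e ! Suc k \<or> x = Q e ! Suc k \<and> y = Q e ! k" by blast
    then show "consecutive (seg e i) x y"
      unfolding consecutive_def using seg_nth[of e i "k - pos e i"] seg_nth[of e i "Suc k - pos e i"]
      by (intro exI[of _ "k - pos e i"]) (auto simp: length_seg Suc_diff_le)
  qed
qed

lemma seg_in_emb:
  assumes e: "e \<in> ME" "Suc i < length (P e)" and x: "x \<in> set (seg e i)" "w \<in> pverts J" "x = emb w"
  shows "w \<in> {P e ! i, P e ! Suc i}"
proof -
  obtain k where k: "x = Q e ! k" "pos e i \<le> k" "k \<le> pos e (Suc i)" using x(1) set_seg by auto
  have "k < length (Q e)" using k(3) pos_less[OF e] by linarith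
  then obtain j where j: "j < length (P e)" "w = P e ! j" "k = pos e j"
    using emb_on_Q[OF e(1) _ x(2)] x(3) k(1) by blast
  have "\<not> j < i" using pos_strict_mono[OF e(1), of j i] e(2) k(2) j(3) by auto
  moreover have "\<not> Suc i < j" using pos_strict_mono[OF e(1), of "Suc i" j] k(3) j(1,3) by auto
  ultimately have "j = i \<or> j = Suc i" by auto
  then show ?thesis using j(2) by blast
qed

lemma P_nth_in_J: "e \<in> ME \<Longrightarrow> i < length (P e) \<Longrightarrow> P e ! i \<in> pverts J"
  unfolding J_verts using nth_mem by blast

lemma emb_ends_in_seg:
  assumes "e \<in> ME" "Suc i < length (P e)"
  shows "emb (P e ! i) \<in> set (seg e i)" "emb (P e ! Suc i) \<in> set (seg e i)"
proof -
  have "pos e i \<le> pos e (Suc i)" using pos_mono assms by simp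
  then show "emb (P e ! i) \<in> set (seg e i)" "emb (P e ! Suc i) \<in> set (seg e i)"
    unfolding set_seg using emb_nth assms by auto
qed

lemma Q_subset_segs:
  assumes e: "e \<in> ME" and k: "Suc k < length (Q e)"
  shows "\<exists>i. Suc i < length (P e) \<and> pos e i \<le> k \<and> k < pos e (Suc i)"
proof (cases "Suc (Suc k) < length (P e)")
  case True
  then show ?thesis by (intro exI[of _ k]) (auto simp: pos_def)
next
  case False
  then show ?thesis using P_length[OF e] k
    by (intro exI[of _ "length (P e) - 2"]) (auto simp: pos_def)
qed

text \<open>Distinct paths share no arc by \<open>P_arcs\<close>. Disjointness outside
  \<open>B\<close> would not exclude two parallel paths that consist of the same single
  edge.\<close>

lemma edge_index_unique:
  assumes e: "e \<in> ME" "Suc i < length (P e)" and f: "f \<in> ME" "Suc j < length (P f)"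
    and eq: "{P e ! i, P e ! Suc i} = {P f ! j, P f ! Suc j}"
  shows "e = f \<and> i = j"
proof -
  have "e = f"
  proof (rule ccontr)
    assume ne: "e \<noteq> f"
    have "(P e ! i, P e ! Suc i) \<in> symcl (set (vwalk_arcs (P e)))"
      using e(2) unfolding in_symcl_vwalk_arcs consecutive_def by blast
    moreover have "(P e ! i, P e ! Suc i) \<in> symcl (set (vwalk_arcs (P f)))"
      using f(2) eq unfolding in_symcl_vwalk_arcs consecutive_def doubleton_eq_iff by blast
    ultimately show False using P_arcs[OF e(1) f(1) ne] by blast
  qed
  moreover have "i = j"
    using eq e f P_nth_eq[OF e(1), of i j] P_nth_eq[OF e(1), of i "Suc j"] P_nth_eq[OF e(1), of "Suc i" j]
      \<open>e = f\<close> unfolding doubleton_eq_iff by auto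
  ultimately show ?thesis by simp
qed

text \<open>Two segments of one path overlap at most in a common end, which is an image; segments of
  different paths meet only in images of branch vertices.\<close>

lemma seg_meets_seg:
  assumes e: "e \<in> ME" "Suc i < length (P e)" and f: "f \<in> ME" "Suc j < length (P f)" and ne: "(e, i) \<noteq> (f, j)"
    and x: "x \<in> set (seg e i)" "x \<in> set (seg f j)"
  shows "x \<in> emb ` pverts J"
proof -
  obtain k where k: "x = Q e ! k" "pos e i \<le> k" "k \<le> pos e (Suc i)" using x(1) set_seg by auto
  obtain l where l: "x = Q f ! l" "pos f j \<le> l" "l \<le> pos f (Suc j)" using x(2) set_seg by auto
  have kl: "k < length (Q e)" "l < length (Q f)" using k l pos_less e f by (meson le_less_trans)+
  show ?thesis
  proof (cases "e = f")
    case True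
    then have "k = l" using Q_nth_eq[OF e(1), of k l] k l kl by simp
    have "i \<noteq> j" using ne True by simp
    then consider "Suc i \<le> j" | "Suc j \<le> i" by linarith
    then have "k = pos e (Suc i) \<or> k = pos e i"
    proof cases
      case 1
      then have "pos e (Suc i) \<le> pos e j" using pos_mono e f True by simp
      then show ?thesis using k l True \<open>k = l\<close> by simp
    next
      case 2
      then have "pos e (Suc j) \<le> pos e i" using pos_mono e f True by simp
      then show ?thesis using k l True \<open>k = l\<close> by simp
    qed
    then have "x = emb (P e ! Suc i) \<or> x = emb (P e ! i)" using emb_nth e k(1) by auto
    then show ?thesis using P_nth_in_J e by auto
  next
    case False
    then have "x \<in> g ` B" using Q_disjoint[OF e(1) f(1)] k(1) l(1) kl nth_mem by (metis IntI subsetD)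
    then show ?thesis using emb_branch J_verts by force
  qed
qed

text \<open>The subgraph induced on all the paths \<open>Q e\<close> has only their edges. It
  subdivides \<open>J\<close> itself, with \<open>emb\<close> placing the vertices and one segment
  for every edge.\<close>

lemma subdivision_in_G: "\<exists>K :: 'a pair_pre_digraph. is_subdivision K (multigraph_of J) \<and> iso_induced K G"
proof -
  interpret J: pair_graph J by (rule J)
  interpret G: pair_graph G by (rule G)
  define S where "S = g ` B \<union> (\<Union>e\<in>ME. set (Q e))"
  define K where "K = \<lparr>pverts = S, parcs = {(x, y) \<in> parcs G. x \<in> S \<and> y \<in> S}\<rparr>"
  have "S \<subseteq> pverts G" using Q_verts unfolding S_def .
  note K = induced_pair_graph[OF G this, folded K_def]
  have K_arcs: "(x, y) \<in> parcs K \<longleftrightarrow> (\<exists>e\<in>ME. consecutive (Q e) x y)" for x y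
  proof -
    have "x \<in> S \<and> y \<in> S" if "e \<in> ME" "consecutive (Q e) x y" for e
      using that nth_mem Suc_lessD unfolding S_def consecutive_def by (metis UN_I Un_iff)
    then show ?thesis using Q_induced[of x y] unfolding K_def S_def by auto
  qed
  define M where "M = medges (multigraph_of J)"
  have M: "M = {{u, v} |u v. (u, v) \<in> parcs J}" unfolding M_def multigraph_of_def by simp
  have edge: "\<exists>e i. e \<in> ME \<and> Suc i < length (P e) \<and> E = {P e ! i, P e ! Suc i}" if E: "E \<in> M" for E
  proof -
    obtain u v where uv: "E = {u, v}" "(u, v) \<in> parcs J" using E M by blast
    then obtain e where e: "e \<in> ME" "consecutive (P e) u v" using J_arcs in_symcl_vwalk_arcs by fastforce
    then show ?thesis using uv(1) unfolding consecutive_def by (metis insert_commute)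
  qed
  \<comment> \<open>An edge of the multigraph is just a pair of vertices; \<open>ix\<close> recovers
    the path and the position on it, which are unique by \<open>edge_index_unique\<close>.\<close>
  define ix where "ix E = (SOME p. fst p \<in> ME \<and> Suc (snd p) < length (P (fst p)) \<and>
      E = {P (fst p) ! snd p, P (fst p) ! Suc (snd p)})" for E
  have ix: "fst (ix E) \<in> ME \<and> Suc (snd (ix E)) < length (P (fst (ix E))) \<and>
      E = {P (fst (ix E)) ! snd (ix E), P (fst (ix E)) ! Suc (snd (ix E))}" if E: "E \<in> M" for E
  proof -
    have "\<exists>p. fst p \<in> ME \<and> Suc (snd p) < length (P (fst p)) \<and>
        E = {P (fst p) ! snd p, P (fst p) ! Suc (snd p)}"
      using edge[OF E] by simp
    then show ?thesis unfolding ix_def by (rule someI_ex)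
  qed
  have ix_M: "{P e ! i, P e ! Suc i} \<in> M \<and> ix {P e ! i, P e ! Suc i} = (e, i)"
    if e: "e \<in> ME" "Suc i < length (P e)" for e i
  proof -
    have "consecutive (P e) (P e ! i) (P e ! Suc i)" using e(2) unfolding consecutive_def by blast
    then have "(P e ! i, P e ! Suc i) \<in> parcs J" using J_arcs e(1) in_symcl_vwalk_arcs by fastforce
    then have E: "{P e ! i, P e ! Suc i} \<in> M" using M by blast
    then show ?thesis using ix[OF E] edge_index_unique[OF e] by (metis prod.collapse)
  qed
  define R where "R E = seg (fst (ix E)) (snd (ix E))" for E
  have M_edge: "E \<subseteq> pverts J \<and> card E = 2" if E: "E \<in> M" for E
  proof -
    obtain u v where uv: "E = {u, v}" "(u, v) \<in> parcs J" using E M by blast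
    then have "u \<noteq> v" using J.no_loops' by blast
    then show ?thesis using uv J.wellformed'[OF uv(2)] by simp
  qed
  have multi: "is_multigraph (multigraph_of J)"
  proof -
    have "M = (\<lambda>(u, v). {u, v}) ` parcs J" unfolding M by auto
    then have "finite M" using J.pair_finite_arcs by simp
    then show ?thesis
      using J.pair_finite_verts M_edge unfolding is_multigraph_def M_def by (simp add: multigraph_of_def)
  qed
  have Rset: "set (R E) \<inter> emb ` pverts J = emb ` E" if E: "E \<in> M" for E
  proof -
    define e i where "e = fst (ix E)" and "i = snd (ix E)"
    have ei: "e \<in> ME" "Suc i < length (P e)" "E = {P e ! i, P e ! Suc i}" using ix[OF E] unfolding e_def i_def by auto
    have "set (seg e i) \<inter> emb ` pverts J \<subseteq> emb ` E" using seg_in_emb[OF ei(1,2)] ei(3) by blast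
    moreover have "emb ` E \<subseteq> set (seg e i) \<inter> emb ` pverts J"
      using emb_ends_in_seg[OF ei(1,2)] P_nth_in_J ei by auto
    ultimately show ?thesis unfolding R_def e_def i_def by blast
  qed
  have path: "vpath (R E) (with_proj K) \<and> {hd (R E), last (R E)} = emb ` E" if E: "E \<in> M" for E
  proof -
    define e i where "e = fst (ix E)" and "i = snd (ix E)"
    have ei: "e \<in> ME" "Suc i < length (P e)" "E = {P e ! i, P e ! Suc i}" using ix[OF E] unfolding e_def i_def by auto
    have RE: "R E = seg e i" unfolding R_def e_def i_def by simp
    have lt: "pos e i < pos e (Suc i)" "pos e (Suc i) < length (Q e)"
      using pos_strict_mono pos_less ei by auto
    have "distinct (seg e i)"
      unfolding seg_def distinct_map
      using lt(2) Q_nth_eq[OF ei(1)] by (auto intro!: inj_onI)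
    moreover have "set (seg e i) \<subseteq> pverts K"
    proof
      fix x assume "x \<in> set (seg e i)"
      then obtain k where "x = Q e ! k" "k \<le> pos e (Suc i)" unfolding set_seg by blast
      then have "x \<in> set (Q e)" using lt(2) by auto
      then show "x \<in> pverts K" using ei(1) unfolding K_def S_def by auto
    qed
    moreover have "set (vwalk_arcs (seg e i)) \<subseteq> parcs K"
    proof (rule subrelI)
      fix x y assume "(x, y) \<in> set (vwalk_arcs (seg e i))"
      then have "consecutive (seg e i) x y" unfolding set_vwalk_arcs consecutive_def by blast
      then obtain k where "k < pos e (Suc i)" "x = Q e ! k \<and> y = Q e ! Suc k \<or> x = Q e ! Suc k \<and> y = Q e ! k"
        using consecutive_seg[OF ei(1,2)] by blast
      then have "consecutive (Q e) x y"
        unfolding consecutive_def using lt(2) by (intro exI[of _ k]) simp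
      then show "(x, y) \<in> parcs K" using K_arcs ei(1) by blast
    qed
    moreover have ne: "seg e i \<noteq> []" using lt length_seg[of e i] by auto
    moreover have "hd (seg e i) = emb (P e ! i)"
      using seg_nth[of e i 0] lt ne emb_nth ei by (simp add: hd_conv_nth)
    moreover have "last (seg e i) = emb (P e ! Suc i)"
      using seg_nth[of e i "pos e (Suc i) - pos e i"] lt ne emb_nth ei length_seg[of e i]
      by (simp add: last_conv_nth)
    ultimately show ?thesis unfolding RE vpath_def vwalk_def by (simp add: ei(3))
  qed
  have meet: "set (R E) \<inter> set (R F) = emb ` (E \<inter> F)" if EF: "E \<in> M" "F \<in> M" "E \<noteq> F" for E F
  proof -
    have sub: "E \<subseteq> pverts J" "F \<subseteq> pverts J" using EF M_edge by blast+
    have "ix E \<noteq> ix F" using ix[OF EF(1)] ix[OF EF(2)] EF(3) by metis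
    then have ne: "(fst (ix E), snd (ix E)) \<noteq> (fst (ix F), snd (ix F))" by simp
    have "set (R E) \<inter> set (R F) \<subseteq> emb ` pverts J"
      using seg_meets_seg[OF _ _ _ _ ne] ix[OF EF(1)] ix[OF EF(2)] unfolding R_def by blast
    then have "set (R E) \<inter> set (R F) = emb ` E \<inter> emb ` F" using Rset[OF EF(1)] Rset[OF EF(2)] by blast
    also have "\<dots> = emb ` (E \<inter> F)" using inj_on_image_Int[OF inj_emb sub] by simp
    finally show ?thesis .
  qed
  \<comment> \<open>The two different ends of a common arc would both be images of vertices in
    \<open>E \<inter> F\<close>, and two edges of \<open>J\<close> with two common ends are
    equal.\<close>
  have arcs_disjoint: "symcl (set (vwalk_arcs (R E))) \<inter> symcl (set (vwalk_arcs (R F))) = {}"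
    if EF: "E \<in> M" "F \<in> M" "E \<noteq> F" for E F
  proof (rule ccontr)
    assume "\<not> ?thesis"
    then obtain x y where xy: "consecutive (R E) x y" "consecutive (R F) x y"
      using in_symcl_vwalk_arcs by fastforce
    have in_set: "x \<in> set p \<and> y \<in> set p" if "consecutive p x y" for p
      using that nth_mem Suc_lessD unfolding consecutive_def by metis
    have "x \<in> emb ` (E \<inter> F)" "y \<in> emb ` (E \<inter> F)"
      using in_set[OF xy(1)] in_set[OF xy(2)] meet[OF EF] by blast+
    moreover have "x \<noteq> y"
    proof -
      have "distinct (R E)" using path[OF EF(1)] unfolding vpath_def by blast
      then show ?thesis using xy(1) nth_eq_iff_index_eq unfolding consecutive_def
        by (metis Suc_lessD n_not_Suc_n)
    qed
    ultimately obtain u v where uv: "u \<in> E \<inter> F" "v \<in> E \<inter> F" "u \<noteq> v" by blast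
    have "card E = 2" "card F = 2" using EF M_edge by blast+
    then have "E = {u, v}" "F = {u, v}" using uv by (auto simp: card_2_iff)
    then show False using EF(3) by simp
  qed
  have vertsK: "pverts K = emb ` pverts J \<union> (\<Union>E\<in>M. set (R E))"
  proof
    show "emb ` pverts J \<union> (\<Union>E\<in>M. set (R E)) \<subseteq> pverts K"
    proof -
      have "set (R E) \<subseteq> pverts K" if "E \<in> M" for E using path[OF that] unfolding vpath_def vwalk_def by simp
      moreover have "emb w \<in> pverts K" if "w \<in> pverts J" for w
        using that
      proof (cases rule: J_vert_cases)
        case 1
        then show ?thesis using emb_branch unfolding K_def S_def by simp
      next
        case (2 e i)
        then show ?thesis using emb_nth pos_less nth_mem unfolding K_def S_def by fastforce
      qed
      ultimately show ?thesis by blast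
    qed
    show "pverts K \<subseteq> emb ` pverts J \<union> (\<Union>E\<in>M. set (R E))"
    proof
      fix x assume "x \<in> pverts K"
      then consider "x \<in> g ` B" | e where "e \<in> ME" "x \<in> set (Q e)" unfolding K_def S_def by auto
      then show "x \<in> emb ` pverts J \<union> (\<Union>E\<in>M. set (R E))"
      proof cases
        case 1
        then show ?thesis using emb_branch J_verts by force
      next
        case 2
        then obtain k where k: "k < length (Q e)" "x = Q e ! k" by (auto simp: in_set_conv_nth)
        show ?thesis
        proof (cases "Suc k < length (Q e)")
          case True
          then obtain i where i: "Suc i < length (P e)" "pos e i \<le> k" "k < pos e (Suc i)"
            using Q_subset_segs[OF 2(1)] by blast
          then have "x \<in> set (seg e i)" using k(2) set_seg by auto
          then have "x \<in> set (R {P e ! i, P e ! Suc i})" using ix_M[OF 2(1) i(1)] unfolding R_def by simp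
          then show ?thesis using ix_M[OF 2(1) i(1)] by blast
        next
          \<comment> \<open>The last vertex of \<open>Q e\<close> starts no edge, but it is the
            image of the last vertex of \<open>P e\<close>.\<close>
          case False
          then have "k = length (Q e) - 1" using k(1) by simp
          then have "x = emb (P e ! (length (P e) - 1))"
            using emb_nth[OF 2(1)] pos_ends(2)[OF 2(1)] P_length[OF 2(1)] k(2) by simp
          then show ?thesis using P_nth_in_J[OF 2(1)] P_length[OF 2(1)] by auto
        qed
      qed
    qed
  qed
  have arcsK: "parcs K = (\<Union>E\<in>M. symcl (set (vwalk_arcs (R E))))"
  proof -
    have "(\<exists>e\<in>ME. consecutive (Q e) x y) \<longleftrightarrow> (\<exists>E\<in>M. consecutive (R E) x y)" for x y
    proof
      assume "\<exists>e\<in>ME. consecutive (Q e) x y"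
      then obtain e k where e: "e \<in> ME" "Suc k < length (Q e)"
        "x = Q e ! k \<and> y = Q e ! Suc k \<or> x = Q e ! Suc k \<and> y = Q e ! k" unfolding consecutive_def by blast
      obtain i where i: "Suc i < length (P e)" "pos e i \<le> k" "k < pos e (Suc i)"
        using Q_subset_segs[OF e(1,2)] by blast
      then have "consecutive (seg e i) x y" using consecutive_seg[OF e(1) i(1)] e(3) by blast
      then show "\<exists>E\<in>M. consecutive (R E) x y"
        using ix_M[OF e(1) i(1)] unfolding R_def by (intro bexI[of _ "{P e ! i, P e ! Suc i}"]) auto
    next
      assume "\<exists>E\<in>M. consecutive (R E) x y"
      then obtain E where E: "E \<in> M" "consecutive (R E) x y" by blast
      have "(x, y) \<in> set (vwalk_arcs (R E)) \<or> (y, x) \<in> set (vwalk_arcs (R E))"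
        using E(2) unfolding set_vwalk_arcs consecutive_def by blast
      then have "(x, y) \<in> parcs K \<or> (y, x) \<in> parcs K"
        using path[OF E(1)] unfolding vpath_def vwalk_def by auto
      then show "\<exists>e\<in>ME. consecutive (Q e) x y" using K_arcs unfolding consecutive_def by blast
    qed
    then show ?thesis using K_arcs by (auto simp: set_eq_iff in_symcl_vwalk_arcs)
  qed
  have mv: "mverts (multigraph_of J) = pverts J" "medges (multigraph_of J) = M" "mends (multigraph_of J) = (\<lambda>e. e)"
    unfolding M_def multigraph_of_def by simp_all
  have "is_subdivision K (multigraph_of J)"
    unfolding is_subdivision_def mv
  proof (intro conjI exI[of _ emb] exI[of _ R] ballI impI)
    show "pair_graph K" "is_multigraph (multigraph_of J)" "inj_on emb (pverts J)"
      by (rule K(1), rule multi, rule inj_emb)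
  qed (use path meet arcs_disjoint vertsK arcsK Rset in auto)
  then show ?thesis using K(2) by blast
qed

end

context simple_graph begin

section \<open>From connectors to long induced paths\<close>

lemma walk_of_reach:
  assumes "reach X a b" "a \<in> X"
  shows "\<exists>p. p \<noteq> [] \<and> hd p = a \<and> last p = b \<and> set p \<subseteq> X \<and> (\<forall>k. Suc k < length p \<longrightarrow> adj (p ! k) (p ! Suc k))"
  using assms(1) unfolding reach_def
proof (induction rule: rtranclp_induct)
  case base
  then show ?case using assms(2) by (intro exI[of _ "[a]"]) auto
next
  case (step y z)
  then obtain p where p: "p \<noteq> []" "hd p = a" "last p = y" "set p \<subseteq> X"
    "\<forall>k. Suc k < length p \<longrightarrow> adj (p ! k) (p ! Suc k)" by blast
  have "adj ((p @ [z]) ! k) ((p @ [z]) ! Suc k)" if k: "Suc k < length (p @ [z])" for k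
  proof (cases "Suc k < length p")
    case True
    then show ?thesis using p(5) by (simp add: nth_append)
  next
    case False
    then have "k = length p - 1" using k by simp
    then show ?thesis using p(1,3) step(2) by (auto simp: nth_append last_conv_nth)
  qed
  then show ?case using p step(2) by (intro exI[of _ "p @ [z]"]) auto
qed

text \<open>A shortest walk will do: a chord or a repeated vertex would allow a shorter one.\<close>

lemma induced_path:
  assumes "reach X a b" "a \<in> X"
  shows "\<exists>p. p \<noteq> [] \<and> hd p = a \<and> last p = b \<and> set p \<subseteq> X \<and> distinct p \<and>
    (\<forall>x\<in>set p. \<forall>y\<in>set p. adj x y \<longleftrightarrow> consecutive p x y)"
proof -
  define W where "W p \<longleftrightarrow> p \<noteq> [] \<and> hd p = a \<and> last p = b \<and> set p \<subseteq> X \<and>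
    (\<forall>k. Suc k < length p \<longrightarrow> adj (p ! k) (p ! Suc k))" for p
  obtain p0 where "W p0" using walk_of_reach[OF assms] unfolding W_def by blast
  then obtain p where p: "W p" and least: "\<And>q. W q \<Longrightarrow> length p \<le> length q"
    using ex_has_least_nat[of W p0 length] by blast
  have p': "p \<noteq> []" "hd p = a" "last p = b" "set p \<subseteq> X" "\<And>k. Suc k < length p \<Longrightarrow> adj (p ! k) (p ! Suc k)"
    using p unfolding W_def by blast+
  have short: "j = Suc i" if ij: "i < j" "j < length p" "adj (p ! i) (p ! j)" for i j
  proof (rule ccontr)
    assume ne: "j \<noteq> Suc i"
    \<comment> \<open>Going along the chord skips everything strictly between positions
      \<open>i\<close> and \<open>j\<close>.\<close>
    define q where "q = take (Suc i) p @ drop j p"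
    have len: "length q = Suc i + (length p - j)" using ij unfolding q_def by simp
    have nth: "q ! k = (if k < Suc i then p ! k else p ! (j + (k - Suc i)))" if "k < length q" for k
      using ij unfolding q_def by (auto simp: nth_append)
    have "adj (q ! k) (q ! Suc k)" if k: "Suc k < length q" for k
    proof -
      consider "Suc k < Suc i" | "k = i" | "Suc i \<le> k" by linarith
      then show ?thesis
      proof cases
        case 1
        then show ?thesis using nth[of k] nth[of "Suc k"] k p'(5)[of k] ij by simp
      next
        case 2
        then show ?thesis using nth[of k] nth[of "Suc k"] k ij by simp
      next
        case 3
        then have "Suc (j + (k - Suc i)) < length p" using k len by simp
        moreover have "Suc (j + (k - Suc i)) = j + (Suc k - Suc i)" using 3 by simp
        ultimately have "adj (p ! (j + (k - Suc i))) (p ! (j + (Suc k - Suc i)))" using p'(5) by metis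
        then show ?thesis using nth[of k] nth[of "Suc k"] k 3 by simp
      qed
    qed
    moreover have "set q \<subseteq> X" using p'(4) set_take_subset set_drop_subset unfolding q_def by fastforce
    moreover have "hd q = a" "last q = b" "q \<noteq> []" using p'(1-3) ij unfolding q_def by (auto simp: hd_append)
    ultimately have "W q" unfolding W_def by blast
    then show False using least[of q] len ij ne by simp
  qed
  have "p ! i \<noteq> p ! j" if ij: "i < j" "j < length p" for i j
  proof
    assume eq: "p ! i = p ! j"
    show False
    proof (cases i)
      case 0
      have "W (drop j p)" unfolding W_def
        using p' ij eq 0 by (auto simp: hd_drop_conv_nth hd_conv_nth dest: in_set_dropD)
      from least[OF this] show False using ij 0 by simp
    next
      case (Suc m)
      \<comment> \<open>The predecessor of the first occurrence is adjacent to the second one, a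
        chord excluded by \<open>short\<close>.\<close>
      then have "adj (p ! m) (p ! j)" using p'(5)[of m] ij eq by simp
      then show False using short[of m j] ij Suc by simp
    qed
  qed
  then have dist: "distinct p" unfolding distinct_conv_nth by (metis linorder_neqE_nat)
  have "adj x y \<longleftrightarrow> consecutive p x y" if xy: "x \<in> set p" "y \<in> set p" for x y
  proof
    assume adj: "adj x y"
    obtain i j where ij: "i < length p" "x = p ! i" "j < length p" "y = p ! j"
      using xy by (auto simp: in_set_conv_nth)
    have "i \<noteq> j" using adj adj_irrefl ij by auto
    then consider "i < j" | "j < i" by linarith
    then show "consecutive p x y"
      using short[of i j] short[of j i] adj adj_sym ij unfolding consecutive_def by cases blast+
  next
    assume "consecutive p x y"
    then show "adj x y" using p'(5) adj_sym unfolding consecutive_def by blast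
  qed
  then show ?thesis using p' dist by blast
qed

lemma path_in_ball:
  assumes "\<forall>k. Suc k < length p \<longrightarrow> adj (p ! k) (p ! Suc k)"
  shows "k < length p \<Longrightarrow> p ! k \<in> ball k (p ! 0)"
  using assms by (induction k) auto

text \<open>Since \<open>b\<close> is outside the ball of radius \<open>R\<close>, the path has more
  than \<open>R\<close> edges and so at least \<open>R + 2\<close> vertices.\<close>

lemma connector_path:
  assumes W: "conn W" "u \<in> W" "adj a u" "v \<in> W" "adj b v" and far: "b \<notin> ball R a"
  shows "\<exists>p. p \<noteq> [] \<and> hd p = a \<and> last p = b \<and> set p \<subseteq> insert a (insert b W) \<and> distinct p \<and> R + 2 \<le> length p \<and>
    (\<forall>x\<in>set p. \<forall>y\<in>set p. adj x y \<longleftrightarrow> consecutive p x y)"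
proof -
  have "conn (insert b (insert a W))"
    using conn_insert[OF conn_insert[OF W(1,2) adj_sym[OF W(3)]] _ adj_sym[OF W(5)]] W(4) by blast
  then have "reach (insert b (insert a W)) a b" unfolding conn_def by blast
  then obtain p where p: "p \<noteq> []" "hd p = a" "last p = b" "set p \<subseteq> insert b (insert a W)" "distinct p"
    "\<forall>x\<in>set p. \<forall>y\<in>set p. adj x y \<longleftrightarrow> consecutive p x y"
    using induced_path[of "insert b (insert a W)" a b] by blast
  have "\<forall>k. Suc k < length p \<longrightarrow> adj (p ! k) (p ! Suc k)"
    using p(6) Suc_lessD nth_mem unfolding consecutive_def by blast
  from path_in_ball[OF this, of "length p - 1"] have "b \<in> ball (length p - 1) a"
    using p(1-3) by (simp add: hd_conv_nth last_conv_nth)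
  then have "\<not> length p - 1 \<le> R" using far ball_mono by blast
  then show ?thesis using p by (intro exI[of _ p]) auto
qed

text \<open>Each connector yields an induced path of more than \<open>R\<close> vertices, longer
  than the path it stands for. No other edges arise: branch vertices are far apart, each
  \<open>W e\<close> sees only its own two, and different \<open>W e\<close> are
  anticomplete.\<close>

lemma subdivision_of_connectors:
  fixes J G :: "'a pair_pre_digraph" and P :: "'e \<Rightarrow> 'a list"
  assumes J: "pair_graph J" and G: "pair_graph G"
    and VG: "V = pverts G" "\<And>x y. adj x y \<longleftrightarrow> (x, y) \<in> parcs G"
    and R: "1 \<le> R"
    and P: "\<And>e. e \<in> ME \<Longrightarrow> distinct (P e)" "\<And>e. e \<in> ME \<Longrightarrow> 2 \<le> length (P e)"
      "\<And>e. e \<in> ME \<Longrightarrow> length (P e) \<le> R" "\<And>e. e \<in> ME \<Longrightarrow> set (P e) \<inter> B = {hd (P e), last (P e)}"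
      "\<And>e f. e \<in> ME \<Longrightarrow> f \<in> ME \<Longrightarrow> e \<noteq> f \<Longrightarrow> set (P e) \<inter> set (P f) \<subseteq> B"
      "\<And>e f. e \<in> ME \<Longrightarrow> f \<in> ME \<Longrightarrow> e \<noteq> f \<Longrightarrow>
        symcl (set (vwalk_arcs (P e))) \<inter> symcl (set (vwalk_arcs (P f))) = {}"
    and JP: "pverts J = B \<union> (\<Union>e\<in>ME. set (P e))" "parcs J = (\<Union>e\<in>ME. symcl (set (vwalk_arcs (P e))))"
    and g: "g ` B \<subseteq> V" "\<And>x y. x \<in> B \<Longrightarrow> y \<in> B \<Longrightarrow> x \<noteq> y \<Longrightarrow> g y \<notin> ball R (g x)"
    and W: "\<And>e. e \<in> ME \<Longrightarrow> conn (W e)" "\<And>e. e \<in> ME \<Longrightarrow> W e \<inter> g ` B = {}"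
      "\<And>e x. e \<in> ME \<Longrightarrow> x \<in> B \<Longrightarrow> (\<exists>v\<in>W e. adj (g x) v) \<longleftrightarrow> x \<in> {hd (P e), last (P e)}"
      "\<And>e f. e \<in> ME \<Longrightarrow> f \<in> ME \<Longrightarrow> e \<noteq> f \<Longrightarrow> anticomplete (W e) (W f)"
  shows "\<exists>K :: 'a pair_pre_digraph. is_subdivision K (multigraph_of J) \<and> iso_induced K G"
proof -
  have inj: "inj_on g B" using g(2) in_ball_self by (intro inj_onI) metis
  define good where "good e p \<longleftrightarrow> p \<noteq> [] \<and> hd p = g (hd (P e)) \<and> last p = g (last (P e)) \<and>
      set p \<subseteq> {g (hd (P e)), g (last (P e))} \<union> W e \<and> distinct p \<and> R + 2 \<le> length p \<and>
      (\<forall>x\<in>set p. \<forall>y\<in>set p. adj x y \<longleftrightarrow> consecutive p x y)" for e p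
  have ends: "hd (P e) \<in> B" "last (P e) \<in> B" "hd (P e) \<noteq> last (P e)" if e: "e \<in> ME" for e
  proof -
    show "hd (P e) \<in> B" "last (P e) \<in> B" using P(4)[OF e] by blast+
    obtain x y zs where "P e = x # y # zs" using P(2)[OF e] by (metis Suc_le_length_iff numeral_2_eq_2)
    then show "hd (P e) \<noteq> last (P e)" using P(1)[OF e] by auto
  qed
  have "\<exists>p. good e p" if e: "e \<in> ME" for e
  proof -
    obtain u where u: "u \<in> W e" "adj (g (hd (P e))) u" using W(3)[OF e ends(1)[OF e]] by blast
    obtain v where v: "v \<in> W e" "adj (g (last (P e))) v" using W(3)[OF e ends(2)[OF e]] by blast
    have far: "g (last (P e)) \<notin> ball R (g (hd (P e)))" by (rule g(2)[OF ends[OF e]])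
    have "insert (g (hd (P e))) (insert (g (last (P e))) (W e)) = {g (hd (P e)), g (last (P e))} \<union> W e"
      by blast
    from connector_path[OF W(1)[OF e] u v far, unfolded this] show ?thesis unfolding good_def .
  qed
  then have "\<forall>e\<in>ME. \<exists>p. good e p" by blast
  then obtain Q where Q: "\<forall>e\<in>ME. good e (Q e)" by (rule bchoice[THEN exE])
  let ?S = "g ` B \<union> (\<Union>e\<in>ME. set (Q e))"
  have Qsub: "x \<in> W e" if "e \<in> ME" "x \<in> set (Q e)" "x \<notin> g ` B" for e x
    using that Q ends unfolding good_def by blast
  have cons: "consecutive (Q e) x y \<longleftrightarrow> adj x y" if "e \<in> ME" "x \<in> set (Q e)" "y \<in> set (Q e)" for e x y
    using that Q unfolding good_def by blast
  have cons_in: "x \<in> set p \<and> y \<in> set p" if "consecutive p x y" for p :: "'a list" and x y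
    using that nth_mem Suc_lessD unfolding consecutive_def by metis
  \<comment> \<open>Connectors are not assumed to lie in \<open>V\<close>; a vertex of a path is in
    \<open>V\<close> because it has a neighbour on that path.\<close>
  have in_V: "x \<in> V" if e: "e \<in> ME" "x \<in> set (Q e)" for e x
  proof -
    obtain k where k: "k < length (Q e)" "x = Q e ! k" using e(2) by (auto simp: in_set_conv_nth)
    have "\<exists>y. consecutive (Q e) x y"
    proof (cases "Suc k < length (Q e)")
      case True
      then show ?thesis using k unfolding consecutive_def by blast
    next
      case False
      have "2 \<le> length (Q e)" using Q e(1) unfolding good_def by force
      then have "Suc (k - 1) = k" using False k by simp
      then show ?thesis using k unfolding consecutive_def by metis
    qed
    then obtain y where y: "consecutive (Q e) x y" by blast
    then have "adj x y" using cons[OF e(1)] cons_in[OF y] by blast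
    then show ?thesis by (rule adj_in_V)
  qed
  have branch_on_Q: "x \<in> {g (hd (P e)), g (last (P e))}" if "e \<in> ME" "x \<in> g ` B" "y \<in> W e" "adj x y" for e x y
    using that W(3)[OF that(1)] by blast
  have ends_on_Q: "g (hd (P e)) \<in> set (Q e)" "g (last (P e)) \<in> set (Q e)" if e: "e \<in> ME" for e
  proof -
    have "Q e \<noteq> []" "hd (Q e) = g (hd (P e))" "last (Q e) = g (last (P e))" using Q e unfolding good_def by blast+
    then show "g (hd (P e)) \<in> set (Q e)" "g (last (P e)) \<in> set (Q e)" by (metis hd_in_set, metis last_in_set)
  qed
  have mixed: "\<exists>e\<in>ME. consecutive (Q e) x y" if x: "x \<in> g ` B" and y: "y \<in> ?S - g ` B" and adj: "adj x y" for x y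
  proof -
    obtain e where e: "e \<in> ME" "y \<in> set (Q e)" using y by blast
    have "x \<in> set (Q e)" using branch_on_Q[OF e(1) x Qsub[OF e] adj] ends_on_Q[OF e(1)] y by blast
    then show ?thesis using cons[OF e(1) _ e(2)] adj e(1) by blast
  qed
  have cons_sym: "consecutive p x y \<Longrightarrow> consecutive p y x" for p :: "'a list" and x y
    unfolding consecutive_def by blast
  have induced: "(x, y) \<in> parcs G \<longleftrightarrow> (\<exists>e\<in>ME. consecutive (Q e) x y)" if xy: "x \<in> ?S" "y \<in> ?S" for x y
  proof
    assume "(x, y) \<in> parcs G"
    then have adj: "adj x y" using VG by blast
    consider "x \<in> g ` B" "y \<in> g ` B" | "x \<in> g ` B" "y \<notin> g ` B" | "x \<notin> g ` B" "y \<in> g ` B"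
      | "x \<notin> g ` B" "y \<notin> g ` B" by blast
    then show "\<exists>e\<in>ME. consecutive (Q e) x y"
    proof cases
      case 1
      then obtain p q where pq: "p \<in> B" "q \<in> B" "x = g p" "y = g q" by blast
      then have "p \<noteq> q" using adj adj_irrefl by auto
      then have far: "y \<notin> ball R x" using g(2) pq by blast
      then show ?thesis using far_not_adj[OF far R] adj by blast
    next
      case 2
      then show ?thesis using mixed[of x y] xy adj by blast
    next
      case 3
      then show ?thesis using mixed[of y x] xy adj_sym[OF adj] cons_sym by blast
    next
      case 4
      then obtain e f where ef: "e \<in> ME" "x \<in> set (Q e)" "f \<in> ME" "y \<in> set (Q f)" using xy by blast
      have "e = f"
      proof (rule ccontr)
        assume "e \<noteq> f"
        then have "anticomplete (W e) (W f)" using W(4) ef by blast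
        then show False using Qsub[OF ef(1,2)] Qsub[OF ef(3,4)] 4 adj unfolding anticomplete_def by blast
      qed
      then show ?thesis using cons ef adj by blast
    qed
  next
    assume "\<exists>e\<in>ME. consecutive (Q e) x y"
    then show "(x, y) \<in> parcs G" using cons cons_in VG by blast
  qed
  have "longer_paths J G B ME P Q g"
  proof (rule longer_paths.intro)
    have Qe: "distinct (Q e)" "hd (Q e) = g (hd (P e))" "last (Q e) = g (last (P e))" if "e \<in> ME" for e
      using Q that unfolding good_def by blast+
    show "distinct (Q e)" "hd (Q e) = g (hd (P e))" "last (Q e) = g (last (P e))" if "e \<in> ME" for e
      using Qe that by blast+
    show "pair_graph J" "pair_graph G" "inj_on g B" by (fact J, fact G, fact inj)
    show "pverts J = B \<union> (\<Union>e\<in>ME. set (P e))" "parcs J = (\<Union>e\<in>ME. symcl (set (vwalk_arcs (P e))))"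
      by (fact JP)+
    show "(x, y) \<in> parcs G \<longleftrightarrow> (\<exists>e\<in>ME. consecutive (Q e) x y)" if "x \<in> ?S" "y \<in> ?S" for x y
      using induced that by blast
    show "set (Q e) \<inter> set (Q f) \<subseteq> g ` B" if ef: "e \<in> ME" "f \<in> ME" "e \<noteq> f" for e f
      using Qsub ef W(4)[OF ef] unfolding anticomplete_def by blast
    show "set (Q e) \<inter> g ` B \<subseteq> {hd (Q e), last (Q e)}" if e: "e \<in> ME" for e
      using Q e W(2)[OF e] unfolding good_def by fastforce
    show "length (P e) \<le> length (Q e)" if "e \<in> ME" for e
      using P(3)[OF that] Q that unfolding good_def by fastforce
    show "?S \<subseteq> pverts G" using g(1) in_V VG by blast
  qed (fact P)+
  then show ?thesis by (rule longer_paths.subdivision_in_G)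
qed

end

section \<open>Local chromatic number\<close>

lemma simple_graph_of_pair_graph:
  assumes "pair_graph G" shows "simple_graph (pverts G) (\<lambda>x y. (x, y) \<in> parcs G)"
proof -
  interpret pair_graph G by fact
  show ?thesis
    by unfold_locales (use pair_finite_verts arcs_symmetric no_loops' wellformed' in auto)
qed

text \<open>The least number is attained because some colouring exists, namely the one giving all
  vertices different colours.\<close>

lemma has_colouring_chromatic_number:
  assumes "finite (verts D)" "\<And>u v. (u, v) \<in> arcs_ends D \<Longrightarrow> u \<in> verts D \<and> v \<in> verts D \<and> u \<noteq> v"
  shows "has_colouring D (chromatic_number D)"
proof -
  obtain c where c: "bij_betw c (verts D) {0..<card (verts D)}"
    using ex_bij_betw_finite_nat[OF assms(1)] by blast
  then have "\<forall>(u, v)\<in>arcs_ends D. c u \<noteq> c v"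
    using assms(2) unfolding bij_betw_def inj_on_def by fast
  moreover have "c ` verts D \<subseteq> {..<card (verts D)}" using c unfolding bij_betw_def by auto
  ultimately have "has_colouring D (card (verts D))" unfolding has_colouring_def by blast
  then show ?thesis unfolding chromatic_number_def by (rule LeastI)
qed

text \<open>A walk of at most \<open>n\<close> arcs costs at most \<open>n\<close>. This carries the
  bound on local chromatic number over to balls.\<close>

lemma ball_subset_closed_nbhd:
  assumes G: "pair_graph G" and v: "v \<in> pverts G"
  shows "simple_graph.ball (\<lambda>x y. (x, y) \<in> parcs G) n v \<subseteq> closed_nbhd G n v"
proof -
  interpret G: pair_graph G by fact
  interpret S: simple_graph "pverts G" "\<lambda>x y. (x, y) \<in> parcs G"
    by (rule simple_graph_of_pair_graph[OF G])
  have walk: "\<exists>p. G.awalk v p u \<and> length p \<le> n" if "u \<in> S.ball n v" for u n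
    using that
  proof (induction n arbitrary: u)
    case 0
    then show ?case using v by (intro exI[of _ "[]"]) (simp add: G.awalk_Nil_iff)
  next
    case (Suc n)
    show ?case
    proof (cases "u \<in> S.ball n v")
      case True
      then show ?thesis using Suc.IH le_SucI by blast
    next
      case False
      then obtain w where w: "w \<in> S.ball n v" "(w, u) \<in> parcs G" using Suc.prems by auto
      obtain p where p: "G.awalk v p w" "length p \<le> n" using Suc.IH[OF w(1)] by blast
      have "G.awalk w [(w, u)] u" using G.wellformed'[OF w(2)] w(2) by (simp add: G.awalk_simps)
      then have "G.awalk v (p @ [(w, u)]) u" using p(1) by (rule G.awalk_appendI[rotated])
      then show ?thesis using p(2) by (intro exI[of _ "p @ [(w, u)]"]) simp
    qed
  qed
  show ?thesis
  proof
    fix u assume "u \<in> S.ball n v"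
    then obtain p where p: "G.awalk v p u" "length p \<le> n" using walk by blast
    have "G.awalk_cost (\<lambda>_. 1) p = real (length p)" by (induction p) (auto simp: G.awalk_cost_def)
    then have "G.\<mu> (\<lambda>_. 1) v u \<le> ereal (real (length p))"
      using G.min_cost_le_walk_cost[OF p(1), of "\<lambda>_. 1"] by simp
    also have "\<dots> \<le> ereal (real n)" using p(2) by simp
    finally have "G.\<mu> (\<lambda>_. 1) v u \<le> ereal (real n)" .
    moreover have "u \<in> pverts G" using p(1) by (rule G.awalk_last_in_verts)
    ultimately show "u \<in> closed_nbhd G n v" unfolding closed_nbhd_def by simp
  qed
qed

text \<open>\<open>Suc t\<close> leaves a colour for the ball \<open>{v}\<close> about a
  \<open>v\<close> that is not a vertex, even when \<open>t\<close> is 0.\<close>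

lemma balls_colourable:
  assumes G: "pair_graph G" and loc: "local_chromatic_number n G \<le> t"
  shows "simple_graph.colourable_set (\<lambda>x y. (x, y) \<in> parcs G)
    (simple_graph.ball (\<lambda>x y. (x, y) \<in> parcs G) n v) (Suc t)"
proof -
  interpret G: pair_graph G by fact
  interpret S: simple_graph "pverts G" "\<lambda>x y. (x, y) \<in> parcs G"
    by (rule simple_graph_of_pair_graph[OF G])
  show ?thesis
  proof (cases "v \<in> pverts G")
    case False
    have "S.ball n v = {v}"
      by (induction n) (use False S.adj_in_V in auto)
    then show ?thesis by (intro S.colourable_setI[of _ "\<lambda>_. 0"]) (use S.adj_irrefl in auto)
  next
    case True
    let ?N = "closed_nbhd G n v"
    let ?D = "with_proj G \<restriction> ?N"
    have N: "?N \<subseteq> pverts G" unfolding closed_nbhd_def by blast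
    have ends: "(x, y) \<in> arcs_ends ?D \<longleftrightarrow> (x, y) \<in> parcs G \<and> x \<in> ?N \<and> y \<in> ?N" for x y
      unfolding arcs_ends_conv by force
    have "has_colouring ?D (chromatic_number ?D)"
      using ends G.no_loops' finite_subset[OF N G.pair_finite_verts]
      by (intro has_colouring_chromatic_number) auto
    moreover have "chromatic_number ?D \<le> t"
    proof -
      have "chromatic_number ?D \<le> local_chromatic_number n G"
        unfolding local_chromatic_number_def using True G.pair_finite_verts by (auto intro!: Max_ge)
      then show ?thesis using loc by simp
    qed
    ultimately obtain c where c: "c ` ?N \<subseteq> {..<chromatic_number ?D}" "\<forall>(u, v)\<in>arcs_ends ?D. c u \<noteq> c v"
      and t: "chromatic_number ?D \<le> t"
      unfolding has_colouring_def by auto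
    have "S.colourable_set ?N (Suc t)"
      by (rule S.colourable_setI[of _ c]) (use c t ends in fastforce)+
    then show ?thesis using ball_subset_closed_nbhd[OF G True] S.colourable_set_mono by blast
  qed
qed

lemma chromatic_number_le:
  assumes G: "pair_graph G" and "simple_graph.colourable_set (\<lambda>x y. (x, y) \<in> parcs G) (pverts G) k"
  shows "chromatic_number (with_proj G) \<le> k"
proof -
  interpret G: pair_graph G by fact
  interpret S: simple_graph "pverts G" "\<lambda>x y. (x, y) \<in> parcs G"
    by (rule simple_graph_of_pair_graph[OF G])
  obtain c where "\<forall>x\<in>pverts G. c x < k" "\<forall>x\<in>pverts G. \<forall>y\<in>pverts G. (x, y) \<in> parcs G \<longrightarrow> c x \<noteq> c y"
    using assms(2) by (rule S.colourable_setE)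
  then have "has_colouring (with_proj G) k"
    unfolding has_colouring_def using G.wellformed' by (intro exI[of _ c]) auto
  then show ?thesis unfolding chromatic_number_def by (rule Least_le)
qed

section \<open>The fattened triangle\<close>

text \<open>The three edges take the three pairs in one of six orders. In each, \<open>v\<close> is
  the common end of \<open>e1\<close> and \<open>e2\<close>, which leaves \<open>{x, y}\<close> for
  \<open>e3\<close>.\<close>

lemma triangle_ends:
  assumes T: "is_triangle T" "medges T = {e1, e2, e3}" "distinct [e1, e2, e3]"
  obtains v x y where "distinct [v, x, y]" "mverts T = {v, x, y}"
    "mends T e1 = {v, x}" "mends T e2 = {v, y}" "mends T e3 = {x, y}"
proof -
  have V: "card (mverts T) = 3" and bij: "bij_betw (mends T) {e1, e2, e3} {S. S \<subseteq> mverts T \<and> card S = 2}"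
    using T unfolding is_triangle_def by auto
  obtain p q r where pqr: "mverts T = {p, q, r}" "distinct [p, q, r]"
    using V by (auto simp: card_3_iff)
  have sub: "mends T e \<subseteq> {p, q, r} \<and> card (mends T e) = 2" if "e \<in> {e1, e2, e3}" for e
    using bij_betwE[OF bij] that pqr by blast
  have pairs: "S = {p, q} \<or> S = {p, r} \<or> S = {q, r}" if "S \<subseteq> {p, q, r}" "card S = 2" for S
    using that pqr by (auto simp: card_2_iff doubleton_eq_iff)
  have inj: "mends T e1 \<noteq> mends T e2" "mends T e1 \<noteq> mends T e3" "mends T e2 \<noteq> mends T e3"
    using bij T(3) unfolding bij_betw_def inj_on_def by auto
  note three = pairs[OF sub[THEN conjunct1] sub[THEN conjunct2], of e1]
    pairs[OF sub[THEN conjunct1] sub[THEN conjunct2], of e2]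
    pairs[OF sub[THEN conjunct1] sub[THEN conjunct2], of e3]
  have "\<exists>v x y. distinct [v, x, y] \<and> {p, q, r} = {v, x, y} \<and>
      mends T e1 = {v, x} \<and> mends T e2 = {v, y} \<and> mends T e3 = {x, y}"
  proof -
    have t: "mends T e1 = {p, q} \<or> mends T e1 = {p, r} \<or> mends T e1 = {q, r}"
      "mends T e2 = {p, q} \<or> mends T e2 = {p, r} \<or> mends T e2 = {q, r}"
      "mends T e3 = {p, q} \<or> mends T e3 = {p, r} \<or> mends T e3 = {q, r}"
      using three by auto
    have ok: ?thesis if "distinct [v, x, y]" "{p, q, r} = {v, x, y}"
      "mends T e1 = {v, x}" "mends T e2 = {v, y}" "mends T e3 = {x, y}" for v x y
      using that by blast
    consider "mends T e1 = {p, q}" "mends T e2 = {p, r}" "mends T e3 = {q, r}"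
      | "mends T e1 = {p, q}" "mends T e2 = {q, r}" "mends T e3 = {p, r}"
      | "mends T e1 = {p, r}" "mends T e2 = {p, q}" "mends T e3 = {q, r}"
      | "mends T e1 = {p, r}" "mends T e2 = {q, r}" "mends T e3 = {p, q}"
      | "mends T e1 = {q, r}" "mends T e2 = {p, q}" "mends T e3 = {p, r}"
      | "mends T e1 = {q, r}" "mends T e2 = {p, r}" "mends T e3 = {p, q}"
      using t inj by metis
    then show ?thesis
    proof cases
      case 1 then show ?thesis using pqr by (intro ok[of p q r]) auto
    next
      case 2 then show ?thesis using pqr by (intro ok[of q p r]) auto
    next
      case 3 then show ?thesis using pqr by (intro ok[of p r q]) auto
    next
      case 4 then show ?thesis using pqr by (intro ok[of r p q]) auto
    next
      case 5 then show ?thesis using pqr by (intro ok[of q r p]) auto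
    next
      case 6 then show ?thesis using pqr by (intro ok[of r q p]) auto
    qed
  qed
  then show thesis using that pqr(1) by metis
qed

text \<open>New edges may reuse the edge they replace but no other, so the three classes stay
  disjoint under successive replacement and each keeps its pair of ends.\<close>

lemma fattened_triangle_edges:
  assumes T: "is_triangle T" "medges T = {e1, e2, e3}" "distinct [e1, e2, e3]"
    and H: "fattens T e1 T1" "fattens T1 e2 T2" "replaces_edge T2 e3 F H"
  obtains F1 F2 v x y where "distinct [v, x, y]" "mverts H = {v, x, y}" "medges H = F1 \<union> F2 \<union> F"
    "finite F1" "finite F2" "finite F" "F1 \<noteq> {}" "F1 \<inter> F2 = {}" "F1 \<inter> F = {}" "F2 \<inter> F = {}"
    "\<forall>e\<in>F1. mends H e = {v, x}" "\<forall>e\<in>F2. mends H e = {v, y}"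
    "\<forall>e\<in>F. mends H e = {x, y}"
proof -
  obtain v x y where vxy: "distinct [v, x, y]" "mverts T = {v, x, y}"
    "mends T e1 = {v, x}" "mends T e2 = {v, y}" "mends T e3 = {x, y}"
    using triangle_ends[OF T] by blast
  obtain F1 where F1: "F1 \<noteq> {}" "finite F1" "F1 \<inter> (medges T - {e1}) = {}"
    and T1: "T1 = \<lparr>mverts = mverts T, medges = (medges T - {e1}) \<union> F1,
      mends = (\<lambda>f. if f \<in> F1 then mends T e1 else mends T f)\<rparr>"
    using H(1) unfolding fattens_def replaces_edge_def by blast
  obtain F2 where F2: "finite F2" "F2 \<inter> (medges T1 - {e2}) = {}"
    and T2: "T2 = \<lparr>mverts = mverts T1, medges = (medges T1 - {e2}) \<union> F2,
      mends = (\<lambda>f. if f \<in> F2 then mends T1 e2 else mends T1 f)\<rparr>"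
    using H(2) unfolding fattens_def replaces_edge_def by blast
  have F: "finite F" "F \<inter> (medges T2 - {e3}) = {}"
    and H': "H = \<lparr>mverts = mverts T2, medges = (medges T2 - {e3}) \<union> F,
      mends = (\<lambda>f. if f \<in> F then mends T2 e3 else mends T2 f)\<rparr>"
    using H(3) unfolding replaces_edge_def by blast+
  have F1': "e2 \<notin> F1" "e3 \<notin> F1" using F1(3) T by auto
  have T1e: "medges T1 = {e2, e3} \<union> F1" using T1 T by auto
  have F2': "F2 \<inter> F1 = {}" "e3 \<notin> F2" using F2(2) T1e F1' T(3) by auto
  have T2e: "medges T2 = {e3} \<union> F1 \<union> F2" using T2 T1e F1' T(3) by auto
  have FF: "F \<inter> F1 = {}" "F \<inter> F2 = {}" using F(2) T2e F1' F2' by auto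
  have He: "medges H = F1 \<union> F2 \<union> F" using H' T2e F1' F2' by auto
  show thesis
    by (rule that[of v x y F1 F2])
      (use vxy F1 F2 F F1' F2' FF He T1 T2 H' in auto)
qed

theorem mainTheorem4:
  fixes T T\<^sub>1 T\<^sub>2 H :: "('v, 'e) multigraph" and e\<^sub>1 e\<^sub>2 e\<^sub>3 :: 'e and F :: "'e set"
  assumes "is_triangle T" and "medges T = {e\<^sub>1, e\<^sub>2, e\<^sub>3}" and "distinct [e\<^sub>1, e\<^sub>2, e\<^sub>3]"
    and "fattens T e\<^sub>1 T\<^sub>1"
    and "fattens T\<^sub>1 e\<^sub>2 T\<^sub>2"
    and "replaces_edge T\<^sub>2 e\<^sub>3 F H" and "card F = 2"
  shows "widespread H"
  unfolding widespread_def
proof (intro allI impI)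
  fix J :: "nat pair_pre_digraph"
  assume "is_subdivision J H"
  note sub = this[unfolded is_subdivision_def]
  from sub have J: "pair_graph J" and H: "is_multigraph H" by blast+
  from sub[THEN conjunct2, THEN conjunct2] obtain \<phi> P where
    \<phi>: "inj_on \<phi> (mverts H)" and
    P1: "\<forall>e\<in>medges H. vpath (P e) (with_proj J) \<and> {hd (P e), last (P e)} = \<phi> ` mends H e \<and>
        set (P e) \<inter> \<phi> ` mverts H = \<phi> ` mends H e" and
    P2: "\<forall>e\<in>medges H. \<forall>f\<in>medges H. e \<noteq> f \<longrightarrow> set (P e) \<inter> set (P f) = \<phi> ` (mends H e \<inter> mends H f) \<and>
        symcl (set (vwalk_arcs (P e))) \<inter> symcl (set (vwalk_arcs (P f))) = {}" and
    JP: "pverts J = \<phi> ` mverts H \<union> (\<Union>e\<in>medges H. set (P e))"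
      "parcs J = (\<Union>e\<in>medges H. symcl (set (vwalk_arcs (P e))))"
    by (elim exE conjE) (rule that)
  obtain F1 F2 v x y where vxy: "distinct [v, x, y]" and Hv: "mverts H = {v, x, y}"
    and He: "medges H = F1 \<union> F2 \<union> F" and fin: "finite F1" "finite F2" "finite F" and "F1 \<noteq> {}"
    and disj: "F1 \<inter> F2 = {}" "F1 \<inter> F = {}" "F2 \<inter> F = {}"
    and ends: "\<forall>e\<in>F1. mends H e = {v, x}" "\<forall>e\<in>F2. mends H e = {v, y}"
      "\<forall>e\<in>F. mends H e = {x, y}"
    by (rule fattened_triangle_edges[OF assms(1-6)])
  \<comment> \<open>One number that is large enough for both fattened classes and positive.\<close>
  define N where "N = card F1 + card F2"
  have N: "N > 0" unfolding N_def using \<open>F1 \<noteq> {}\<close> fin by (simp add: card_gt_0_iff)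
  obtain h1 h2 h3 where h: "bij_betw h1 F1 {0..<card F1}" "bij_betw h2 F2 {0..<card F2}" "bij_betw h3 F {0..<card F}"
    using ex_bij_betw_finite_nat fin by metis
  \<comment> \<open>Sends the three edge classes into the three index blocks of
    \<open>connected_triple\<close>.\<close>
  define ix where "ix e = (if e \<in> F1 then h1 e else if e \<in> F2 then N + h2 e else 2 * N + h3 e)" for e
  have h_less: "\<And>e. e \<in> F1 \<Longrightarrow> h1 e < N" "\<And>e. e \<in> F2 \<Longrightarrow> h2 e < N" "\<And>e. e \<in> F \<Longrightarrow> h3 e < 2"
    using bij_betwE[OF h(1)] bij_betwE[OF h(2)] bij_betwE[OF h(3)] assms(7) unfolding N_def by fastforce+
  have ix: "\<And>e. e \<in> F1 \<Longrightarrow> ix e < N" "\<And>e. e \<in> F2 \<Longrightarrow> ix e \<in> {N..<2*N}" "\<And>e. e \<in> F \<Longrightarrow> ix e \<in> {2*N..<2*N+2}"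
    using h_less disj unfolding ix_def by auto
  have ix_bound: "ix e < 2 * N + 2" if "e \<in> medges H" for e
    using ix that unfolding He by fastforce
  have ix_inj: "ix e \<noteq> ix f" if ef: "e \<in> medges H" "f \<in> medges H" "e \<noteq> f" for e f
  proof
    assume eq: "ix e = ix f"
    have inj: "inj_on h1 F1" "inj_on h2 F2" "inj_on h3 F" using h unfolding bij_betw_def by blast+
    have val: "e \<in> F2 \<Longrightarrow> ix e = N + h2 e" "e \<in> F \<Longrightarrow> ix e = 2 * N + h3 e" for e
      using disj unfolding ix_def by auto
    consider "e \<in> F1" "f \<in> F1" | "e \<in> F2" "f \<in> F2" | "e \<in> F" "f \<in> F"
      using ef(1,2) ix[of e] ix[of f] eq unfolding He by fastforce
    then show False
    proof cases
      case 1
      then have "h1 e = h1 f" using eq unfolding ix_def by simp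
      then show False using inj_onD[OF inj(1)] 1 ef(3) by blast
    next
      case 2
      then have "h2 e = h2 f" using eq val(1)[of e] val(1)[of f] by simp
      then show False using inj_onD[OF inj(2)] 2 ef(3) by blast
    next
      case 3
      then have "h3 e = h3 f" using eq val(2)[of e] val(2)[of f] by simp
      then show False using inj_onD[OF inj(3)] 3 ef(3) by blast
    qed
  qed
  \<comment> \<open>At least 3, as the legs require, and at least the length of each path of
    \<open>J\<close>. It depends on \<open>J\<close> alone, so \<open>Suc R\<close> can serve as the
    radius for every ideal.\<close>
  define R where "R = 3 + (\<Sum>e\<in>medges H. length (P e))"
  have fin_H: "finite (medges H)" using fin He by simp
  show "\<exists>\<rho>. \<forall>C. is_ideal C \<and> rho_bounded \<rho> C \<and> (\<forall>G\<in>C. subdivision_free (multigraph_of J) G) \<longrightarrow> colourable C"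
  proof (intro exI[of _ "Suc R"] allI impI)
    fix C assume C: "is_ideal C \<and> rho_bounded (Suc R) C \<and> (\<forall>G\<in>C. subdivision_free (multigraph_of J) G)"
    then obtain \<tau> where \<tau>: "\<And>G. G \<in> C \<Longrightarrow> local_chromatic_number (Suc R) G \<le> \<tau>"
      unfolding rho_bounded_def by blast
    define t where "t = Suc \<tau>"
    define n where "n = t ^ 3 * (2 * N + 2) * Suc (6 * N)"
    have "chromatic_number (with_proj G) \<le> 2 ^ n * (2 ^ (n * n) * (5 * t))" if GC: "G \<in> C" for G
    proof (rule ccontr)
      assume large: "\<not> ?thesis"
      have G: "pair_graph G" using C GC unfolding is_ideal_def by blast
      interpret S: simple_graph "pverts G" "\<lambda>x y. (x, y) \<in> parcs G"
        by (rule simple_graph_of_pair_graph[OF G])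
      have "S.connected_triple R N"
      proof (rule S.connected_triple_exists[OF _ _ n_def])
        show "S.colourable_set (S.ball (Suc R) v) t" for v
          unfolding t_def by (rule balls_colourable[OF G \<tau>[OF GC]])
        show "3 \<le> R" unfolding R_def by simp
        show "\<not> S.colourable_set (pverts G) (2 ^ n * (2 ^ (n * n) * (5 * t)))"
          using large chromatic_number_le[OF G] by blast
      qed
      then obtain a b c W where far: "b \<notin> S.ball R a" "c \<notin> S.ball R a" "c \<notin> S.ball R b"
        and con: "\<forall>i<N. S.connector (W i) a b c" "\<forall>i\<in>{N..<2*N}. S.connector (W i) a c b"
          "\<forall>i\<in>{2*N..<2*N+2}. S.connector (W i) b c a"
        and anti: "\<forall>i<2*N+2. \<forall>j<2*N+2. i \<noteq> j \<longrightarrow> S.anticomplete (W i) (W j)"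
        unfolding S.connected_triple_def by blast
      define B where "B = \<phi> ` mverts H"
      have \<phi>_ne: "\<phi> v \<noteq> \<phi> x" "\<phi> v \<noteq> \<phi> y" "\<phi> x \<noteq> \<phi> y"
        using \<phi> vxy unfolding Hv inj_on_def by auto
      \<comment> \<open>The common end \<open>v\<close> of the two fattened edges goes to the hub
        \<open>a\<close>; the ends of the doubled edge go to \<open>b\<close> and
        \<open>c\<close>.\<close>
      define g where "g w = (if w = \<phi> v then a else if w = \<phi> x then b else c)" for w
      have B: "B = {\<phi> v, \<phi> x, \<phi> y}" unfolding B_def Hv by simp
      have g: "g (\<phi> v) = a" "g (\<phi> x) = b" "g (\<phi> y) = c" unfolding g_def using \<phi>_ne by auto
      have gB: "g ` B = {a, b, c}" unfolding B using g by simp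
      have hl: "{hd (P e), last (P e)} = \<phi> ` mends H e" if "e \<in> medges H" for e using P1 that by blast
      have W: "S.conn (W (ix e)) \<and> W (ix e) \<inter> g ` B = {} \<and>
          (\<forall>w\<in>B. (\<exists>u\<in>W (ix e). (g w, u) \<in> parcs G) \<longleftrightarrow> w \<in> {hd (P e), last (P e)})" if e: "e \<in> medges H" for e
      proof -
        consider "e \<in> F1" | "e \<in> F2" | "e \<in> F" using e He by blast
        then show ?thesis
        proof cases
          case 1
          then have "S.connector (W (ix e)) a b c" using con ix by blast
          then show ?thesis unfolding S.connector_def gB hl[OF e] ends(1)[rule_format, OF 1] B using g \<phi>_ne by auto
        next
          case 2
          then have "S.connector (W (ix e)) a c b" using con ix by blast
          then show ?thesis unfolding S.connector_def gB hl[OF e] ends(2)[rule_format, OF 2] B using g \<phi>_ne by auto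
        next
          case 3
          then have "S.connector (W (ix e)) b c a" using con ix by blast
          then show ?thesis unfolding S.connector_def gB hl[OF e] ends(3)[rule_format, OF 3] B using g \<phi>_ne by auto
        qed
      qed
      have "\<exists>K :: nat pair_pre_digraph. is_subdivision K (multigraph_of J) \<and> iso_induced K G"
      proof (rule S.subdivision_of_connectors[OF J G refl _ _ _ _ _ _ _ _ _ _ _ _ W[THEN conjunct1]])
        show "1 \<le> R" unfolding R_def by simp
        show "distinct (P e)" if "e \<in> medges H" for e using P1[rule_format, OF that] unfolding vpath_def by blast
        show "2 \<le> length (P e)" if e: "e \<in> medges H" for e
        proof -
          have "mends H e \<subseteq> mverts H" "card (mends H e) = 2" using H e unfolding is_multigraph_def by blast+
          then have "card (\<phi> ` mends H e) = 2" using \<phi> card_image inj_on_subset by metis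
          then have "card {hd (P e), last (P e)} = 2" by (simp only: hl[OF e])
          then have ne: "hd (P e) \<noteq> last (P e)" by auto
          have "P e \<noteq> []" using P1[rule_format, OF e] unfolding vpath_def vwalk_def by blast
          then show ?thesis using ne by (cases "P e") (auto simp: Suc_le_eq)
        qed
        show "length (P e) \<le> R" if "e \<in> medges H" for e
          using member_le_sum[OF that, of "\<lambda>e. length (P e)"] fin_H unfolding R_def by simp
        show "set (P e) \<inter> B = {hd (P e), last (P e)}" if "e \<in> medges H" for e
          using P1 that unfolding B_def by simp
        show "set (P e) \<inter> set (P f) \<subseteq> B" if "e \<in> medges H" "f \<in> medges H" "e \<noteq> f" for e f
        proof -
          have "mends H e \<subseteq> mverts H" using H that unfolding is_multigraph_def by blast
          then show ?thesis using P2[rule_format, OF that] unfolding B_def by blast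
        qed
        show "symcl (set (vwalk_arcs (P e))) \<inter> symcl (set (vwalk_arcs (P f))) = {}"
          if "e \<in> medges H" "f \<in> medges H" "e \<noteq> f" for e f using P2 that by blast
        show "pverts J = B \<union> (\<Union>e\<in>medges H. set (P e))" "parcs J = (\<Union>e\<in>medges H. symcl (set (vwalk_arcs (P e))))"
          using JP unfolding B_def by simp_all
        show "g ` B \<subseteq> pverts G"
        proof -
          \<comment> \<open>Having a neighbour in a connector shows that a point is a vertex of
            \<open>G\<close>; for \<open>a\<close> this relies on \<open>N > 0\<close>.\<close>
          have "S.connector (W 0) a b c" "S.connector (W (2*N)) b c a" using con N by simp_all
          then show ?thesis unfolding gB S.connector_def using S.adj_in_V by blast
        qed
        show "g q \<notin> S.ball R (g p)" if "p \<in> B" "q \<in> B" "p \<noteq> q" for p q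
          using that far S.ball_sym g unfolding B by auto
        show "W (ix e) \<inter> g ` B = {}" if "e \<in> medges H" for e using W[OF that] by blast
        show "(\<exists>u\<in>W (ix e). (g w, u) \<in> parcs G) \<longleftrightarrow> w \<in> {hd (P e), last (P e)}" if "e \<in> medges H" "w \<in> B" for e w
          using W[OF that(1)] that(2) by blast
        show "S.anticomplete (W (ix e)) (W (ix f))" if "e \<in> medges H" "f \<in> medges H" "e \<noteq> f" for e f
          using anti ix_bound ix_inj that by blast
      qed simp
      then show False using C GC unfolding subdivision_free_def by blast
    qed
    then show "colourable C" unfolding colourable_def by blast
  qed
qed

end
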